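(* Let $M$ be a checking stack automaton (CSA). For each $z\in\{{\rm a},{\rm s}\}$, exactly one of the following must occur: 1. $M$ is $z$-unlimited, and so there is no function $f$ such that $\sigma^z_M(n)\in O(f(n))$ (in other words, $\sigma^z_M$ takes an infinite value on some input); 2. $M$ is $z$-limited, $\sigma^z_M(n)\in O(1)$, and $L(M)$ is regular; 3. $M$ is $z$-limited, $\sigma^z_M(n)\in O(n)$, $\sigma^z_M(n)\notin o(n)$, and $\overline{\sigma}^z_M(n)\in\Theta(n)$. Moreover, in case 1 and in case 3 the language $L(M)$ can be either regular or not (that is, for each $z\in\{{\rm a},{\rm s}\}$ and each of the cases 1 and 3, there is a CSA $M$ in that case with $L(M)$ regular and a CSA $M$ in that case with $L(M)$ non-regular).
   Context: **Stack automata.** A one-way nondeterministic stack automaton (SA) is a 6-tuple $M=(Q,\Sigma,\Gamma,\delta,q_0,F)$: $Q$ is a finite set of states; $\Sigma,\Gamma$ are the (finite) input and stack alphabets; $\Gamma$ contains two special symbols $\triangleright$ (bottom marker) and $\triangleleft$ (top marker), and $\Gamma_0=\Gamma\setminus\{\triangleright,\triangleleft\}$; $q_0\in Q$ is the initial state; $F\subseteq Q$ is the set of final states; $\delta$ is a nondeterministic transition function from $Q\times(\Sigma\cup\{\lambda\})\times\Gamma$ into subsets of $Q\times\{\mathtt{stay},\mathtt{push}(x),\mathtt{pop},-1,0,+1 \mid x\in\Gamma_0\}$ ($\lambda$ is the empty word). Write $(q,a,y)\to(p,\iota)$ for $(p,\iota)\in\delta(q,a,y)$. A configuration is a triple $c=(q,w,\gamma)$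 with $q\in Q$ the current state, $w\in\Sigma^*$ the remaining input, and $\gamma\in \triangleright\Gamma_0^*\uparrow\Gamma_0^*\triangleleft$ or $\gamma\in\triangleright\Gamma_0^*\triangleleft\uparrow$, where $\uparrow\notin\Gamma$ marks the stack head, which scans the symbol directly preceding it. The stack size of $c$ is $\|c\|_\Gamma=|\gamma|-3$ (number of symbols of $\Gamma_0$ on the stack). Write relation $\vdash_w$: if $(q,a,x)\to(p,\iota)$ with $x\in\Gamma_0\cup\{\triangleright\}$, $a\in\Sigma\cup\{\lambda\}$, then for $u\in\Sigma^*$ and $\gamma x\triangleleft\in\triangleright\Gamma_0^*\triangleleft$: $(q,au,\gamma x\uparrow\triangleleft)\vdash_w(p,u,\gamma x\uparrow\triangleleft)$ if $\iota=\mathtt{stay}$; $(q,au,\gamma x\uparrow\triangleleft)\vdash_w(p,u,\gamma xy\uparrow\triangleleft)$ if $\iota=\mathtt{push}(y)$; $(q,au,\gamma x\uparrow\triangleleft)\vdash_w(p,u,\gamma\uparrow\triangleleft)$ if $\iota=\mathtt{pop}$ and $x\ne\triangleright$. (These moves are undefined if the head is not at the topmost stack symbol.) Read relation $\vdash_r$: if $(q,a,x)\to(p,\iota)$ with $x\in\Gamma$, then for $u\in\Sigma^*$ and $\gamma_1x\gamma_2\in\triangleright\Gamma_0^*\triangleleft$: $(q,au,\gamma_1x\uparrow\gamma_2)\vdash_r(p,u,\gamma_1\uparrow x\gamma_2)$ if $\iota=-1$ and $x\neq\triangleright$; $(q,au,\gamma_1x\uparrow\gamma_2)\vdash_r(p,u,\gamma_1x\uparrow\gamma_2)$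 if $\iota=0$; $(q,au,\gamma_1x\uparrow\gamma_2)\vdash_r(p,u,\gamma_1xy\uparrow\gamma_2')$ if $\iota=+1$ and $\gamma_2=y\gamma_2'$, $y\in\Gamma$. Let $\vdash=\vdash_w\cup\vdash_r$. A partial computation on $u\in\Sigma^*$ is a finite sequence of configurations $c_0\vdash\cdots\vdash c_m$ with $c_0=(q_0,u,\triangleright\uparrow\triangleleft)$. It is a computation if the remaining input in $c_m$ is $\lambda$, and an accepting computation if moreover the state of $c_m$ is in $F$. Its stack size is $\|\mathcal C\|_\Gamma=\max_j\|c_j\|_\Gamma$. The accepted language $L(M)$ is the set of words on which $M$ has an accepting computation. An SA has partitioned states if $Q$ is a disjoint union $Q_w\cup Q_r$ (write states and read states), $F\subseteq Q_r$, all transitions from states in $Q_w$ have $\iota\in\{\mathtt{stay},\mathtt{push}(x),\mathtt{pop}\}$ and all transitions from states in $Q_r$ have $\iota\in\{-1,0,+1\}$. An SA is non-erasing (NESA) if it has no $\mathtt{pop}$ transitions. A checking stack automaton (CSA) is a NESA with partitioned states and with no transitions from a read state to a write state. **Accept and strong space measures.** For $u\in\Sigma^*$: $\sigma^{\rm a}_M(u)$ is the maximum of $\|\mathcal C\|_\Gamma$ over accepting computations $\mathcal C$ of $M$ on $u$ if $u\in L(M)$ and this maximum exists, $\infty$ if $u\in L(M)$ and $M$ has accepting computations on $u$ of arbitrarily large stack size, and $0$ if $u\notin L(M)$. $\sigma^{\rm s}_M(u)$ is the maximum of $\|\mathcal C\|_\Gamma$ over all partial computations $\mathcal C$ of $M$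 on $u$ if it exists, and $\infty$ otherwise. For $z\in\{{\rm a},{\rm s}\}$, $\sigma^z_M(n)=\max\{\sigma^z_M(u)\mid u\in\Sigma^*,|u|=n\}$ and $\overline{\sigma}^z_M(n)=\max\{\sigma^z_M(u)\mid u\in\Sigma^*,|u|\le n\}$. $M$ is $z$-unlimited if $\sigma^z_M(u)=\infty$ for some word $u$, and $z$-limited otherwise. Convention: if $\sigma^z_M$ takes the value $\infty$ even for a single word, then $\sigma^z_M(n)$ is regarded as not being in $O(f(n))$ for any integer function $f$. $f\in o(g)$ means: for all $c>0$ there is $n_0$ such that $f(n)<c\,g(n)$ for all $n>n_0$. *)

theory Defs
  imports "HOL-Library.Extended_Nat" "HOL-Library.Landau_Symbols"
begin

section \<open>Stack automata\<close>

text \<open>The two end markers are constructors, so the type argument ranges over the symbols of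
  \<open>\<Gamma>\<^sub>0\<close> only.\<close>

datatype 'g stack_symbol = Bottom | Top | Sym 'g

datatype 'g stack_instr = Stay | Push 'g | Pop | Down | Hold | Up

text \<open>\<open>Down\<close>, \<open>Hold\<close>, \<open>Up\<close> are the head moves \<open>-1\<close>, \<open>0\<close>, \<open>+1\<close>. The field \<open>work_alph\<close> is
  \<open>\<Gamma>\<^sub>0\<close>. A transition \<open>(p, i) \<in> \<delta>(q, a, y)\<close> is the element \<open>((q, a, y), (p, i))\<close> of \<open>delta\<close>,
  where \<open>a = None\<close> stands for the empty word.\<close>

record ('q, 'a, 'g) sa =
  states :: "'q set"
  input_alph :: "'a set"
  work_alph :: "'g set"
  delta :: "(('q \<times> 'a option \<times> 'g stack_symbol) \<times> ('q \<times> 'g stack_instr)) set"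
  init :: 'q
  final :: "'q set"

definition stack_alph :: "('q, 'a, 'g) sa \<Rightarrow> 'g stack_symbol set" where
  "stack_alph M = {Bottom, Top} \<union> Sym ` work_alph M"

definition instrs :: "('q, 'a, 'g) sa \<Rightarrow> 'g stack_instr set" where
  "instrs M = {Stay, Pop, Down, Hold, Up} \<union> Push ` work_alph M"

definition stack_automaton :: "('q, 'a, 'g) sa \<Rightarrow> bool" where
  "stack_automaton M \<longleftrightarrow>
     finite (states M) \<and> finite (input_alph M) \<and> finite (work_alph M) \<and>
     init M \<in> states M \<and> final M \<subseteq> states M \<and>
     delta M \<subseteq> (states M \<times> insert None (Some ` input_alph M) \<times> stack_alph M)
                 \<times> (states M \<times> instrs M)"

definition partitioned_into :: "('q, 'a, 'g) sa \<Rightarrow> 'q set \<Rightarrow> 'q set \<Rightarrow> bool" where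
  "partitioned_into M Qw Qr \<longleftrightarrow>
     states M = Qw \<union> Qr \<and> Qw \<inter> Qr = {} \<and> final M \<subseteq> Qr \<and>
     (\<forall>q a y p i. ((q, a, y), (p, i)) \<in> delta M \<longrightarrow>
        (q \<in> Qw \<longrightarrow> i \<in> {Stay, Pop} \<union> range Push) \<and>
        (q \<in> Qr \<longrightarrow> i \<in> {Down, Hold, Up}))"

definition non_erasing :: "('q, 'a, 'g) sa \<Rightarrow> bool" where
  "non_erasing M \<longleftrightarrow> (\<forall>q a y p. ((q, a, y), (p, Pop)) \<notin> delta M)"

definition checking_stack_automaton :: "('q, 'a, 'g) sa \<Rightarrow> bool" where
  "checking_stack_automaton M \<longleftrightarrow>
     stack_automaton M \<and> non_erasing M \<and>
     (\<exists>Qw Qr. partitioned_into M Qw Qr \<and>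
        (\<forall>q a y p i. ((q, a, y), (p, i)) \<in> delta M \<longrightarrow> q \<in> Qr \<longrightarrow> p \<notin> Qw))"


section \<open>Configurations and computations\<close>

text \<open>A stack word \<open>\<gamma>\<^sub>1\<up>\<gamma>\<^sub>2\<close> with head marker is the pair \<open>(\<gamma>\<^sub>1, \<gamma>\<^sub>2)\<close>; the scanned symbol is
  the last one of \<open>\<gamma>\<^sub>1\<close>.\<close>

type_synonym ('q, 'a, 'g) config =
  "'q \<times> 'a list \<times> 'g stack_symbol list \<times> 'g stack_symbol list"

definition stack_words :: "('q, 'a, 'g) sa \<Rightarrow> 'g stack_symbol list set" where
  "stack_words M = {[Bottom] @ map Sym xs @ [Top] | xs. xs \<in> lists (work_alph M)}"

text \<open>Two symbols are subtracted for the end markers; the head marker is not part of either list.\<close>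

fun config_size :: "('q, 'a, 'g) config \<Rightarrow> nat" where
  "config_size (q, w, \<gamma>1, \<gamma>2) = length \<gamma>1 + length \<gamma>2 - 2"

fun consumed :: "'a option \<Rightarrow> 'a list" where
  "consumed None = []"
| "consumed (Some a) = [a]"

text \<open>In the write rules, membership in \<^const>\<open>stack_words\<close> already forces \<open>x \<noteq> Top\<close>.\<close>

inductive write_step ::
    "('q, 'a, 'g) sa \<Rightarrow> ('q, 'a, 'g) config \<Rightarrow> ('q, 'a, 'g) config \<Rightarrow> bool"
  for M where
  stay: "((q, a, x), (p, Stay)) \<in> delta M \<Longrightarrow> u \<in> lists (input_alph M) \<Longrightarrow>
    \<gamma> @ [x, Top] \<in> stack_words M \<Longrightarrow>
    write_step M (q, consumed a @ u, \<gamma> @ [x], [Top]) (p, u, \<gamma> @ [x], [Top])"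
| push: "((q, a, x), (p, Push y)) \<in> delta M \<Longrightarrow> u \<in> lists (input_alph M) \<Longrightarrow>
    \<gamma> @ [x, Top] \<in> stack_words M \<Longrightarrow>
    write_step M (q, consumed a @ u, \<gamma> @ [x], [Top]) (p, u, \<gamma> @ [x, Sym y], [Top])"
| pop: "((q, a, x), (p, Pop)) \<in> delta M \<Longrightarrow> u \<in> lists (input_alph M) \<Longrightarrow>
    \<gamma> @ [x, Top] \<in> stack_words M \<Longrightarrow> x \<noteq> Bottom \<Longrightarrow>
    write_step M (q, consumed a @ u, \<gamma> @ [x], [Top]) (p, u, \<gamma>, [Top])"

inductive read_step ::
    "('q, 'a, 'g) sa \<Rightarrow> ('q, 'a, 'g) config \<Rightarrow> ('q, 'a, 'g) config \<Rightarrow> bool"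
  for M where
  down: "((q, a, x), (p, Down)) \<in> delta M \<Longrightarrow> u \<in> lists (input_alph M) \<Longrightarrow>
    \<gamma>1 @ [x] @ \<gamma>2 \<in> stack_words M \<Longrightarrow> x \<noteq> Bottom \<Longrightarrow>
    read_step M (q, consumed a @ u, \<gamma>1 @ [x], \<gamma>2) (p, u, \<gamma>1, [x] @ \<gamma>2)"
| hold: "((q, a, x), (p, Hold)) \<in> delta M \<Longrightarrow> u \<in> lists (input_alph M) \<Longrightarrow>
    \<gamma>1 @ [x] @ \<gamma>2 \<in> stack_words M \<Longrightarrow>
    read_step M (q, consumed a @ u, \<gamma>1 @ [x], \<gamma>2) (p, u, \<gamma>1 @ [x], \<gamma>2)"
| up: "((q, a, x), (p, Up)) \<in> delta M \<Longrightarrow> u \<in> lists (input_alph M) \<Longrightarrow>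
    \<gamma>1 @ [x] @ [y] @ \<gamma>2 \<in> stack_words M \<Longrightarrow>
    read_step M (q, consumed a @ u, \<gamma>1 @ [x], [y] @ \<gamma>2) (p, u, \<gamma>1 @ [x, y], \<gamma>2)"

definition step :: "('q, 'a, 'g) sa \<Rightarrow> ('q, 'a, 'g) config \<Rightarrow> ('q, 'a, 'g) config \<Rightarrow> bool" where
  "step M c c' \<longleftrightarrow> write_step M c c' \<or> read_step M c c'"

definition partial_computation ::
    "('q, 'a, 'g) sa \<Rightarrow> 'a list \<Rightarrow> ('q, 'a, 'g) config list \<Rightarrow> bool" where
  "partial_computation M u cs \<longleftrightarrow>
     u \<in> lists (input_alph M) \<and> cs \<noteq> [] \<and> hd cs = (init M, u, [Bottom], [Top]) \<and>
     successively (step M) cs"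

definition computation ::
    "('q, 'a, 'g) sa \<Rightarrow> 'a list \<Rightarrow> ('q, 'a, 'g) config list \<Rightarrow> bool" where
  "computation M u cs \<longleftrightarrow> partial_computation M u cs \<and> fst (snd (last cs)) = []"

definition accepting_computation ::
    "('q, 'a, 'g) sa \<Rightarrow> 'a list \<Rightarrow> ('q, 'a, 'g) config list \<Rightarrow> bool" where
  "accepting_computation M u cs \<longleftrightarrow> computation M u cs \<and> fst (last cs) \<in> final M"

definition computation_size :: "('q, 'a, 'g) config list \<Rightarrow> nat" where
  "computation_size cs = Max (config_size ` set cs)"

definition accepted_language :: "('q, 'a, 'g) sa \<Rightarrow> 'a list set" where
  "accepted_language M = {u \<in> lists (input_alph M). \<exists>cs. accepting_computation M u cs}"

text \<open>Acceptance by a deterministic finite automaton over the alphabet \<open>A\<close>. Since its state set is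
  finite, taking states from \<^typ>\<open>nat\<close> is no restriction.\<close>

definition regular_language :: "'a set \<Rightarrow> 'a list set \<Rightarrow> bool" where
  "regular_language A L \<longleftrightarrow> finite A \<and>
     (\<exists>(Q :: nat set) d q0 F. finite Q \<and> q0 \<in> Q \<and> F \<subseteq> Q \<and> (\<forall>q\<in>Q. \<forall>a\<in>A. d q a \<in> Q) \<and>
        L = {w \<in> lists A. foldl d q0 w \<in> F})"


section \<open>Space measures\<close>

datatype measure_kind = Accept | Strong

text \<open>On \<^typ>\<open>enat\<close>, \<^const>\<open>Sup\<close> is \<open>0\<close> for the empty set, the maximum of a nonempty finite set and
  \<open>\<infinity>\<close> otherwise. Hence the accept measure is \<open>0\<close> on words that are not accepted.\<close>

fun word_space :: "measure_kind \<Rightarrow> ('q, 'a, 'g) sa \<Rightarrow> 'a list \<Rightarrow> enat" where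
  "word_space Accept M u = (SUP cs \<in> {cs. accepting_computation M u cs}. enat (computation_size cs))"
| "word_space Strong M u = (SUP cs \<in> {cs. partial_computation M u cs}. enat (computation_size cs))"

text \<open>The suprema below range over finitely many words when the input alphabet is finite.\<close>

definition length_space :: "measure_kind \<Rightarrow> ('q, 'a, 'g) sa \<Rightarrow> nat \<Rightarrow> enat" where
  "length_space z M n = (SUP u \<in> {u \<in> lists (input_alph M). length u = n}. word_space z M u)"

definition space_upto :: "measure_kind \<Rightarrow> ('q, 'a, 'g) sa \<Rightarrow> nat \<Rightarrow> enat" where
  "space_upto z M n = (SUP u \<in> {u \<in> lists (input_alph M). length u \<le> n}. word_space z M u)"

definition unlimited :: "measure_kind \<Rightarrow> ('q, 'a, 'g) sa \<Rightarrow> bool" where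
  "unlimited z M \<longleftrightarrow> (\<exists>u \<in> lists (input_alph M). word_space z M u = \<infinity>)"

abbreviation limited :: "measure_kind \<Rightarrow> ('q, 'a, 'g) sa \<Rightarrow> bool" where
  "limited z M \<equiv> \<not> unlimited z M"

text \<open>A function that takes the value \<open>\<infinity>\<close> anywhere, even at a single argument, belongs to none of
  the classes below.\<close>

definition in_bigo :: "(nat \<Rightarrow> enat) \<Rightarrow> (nat \<Rightarrow> real) \<Rightarrow> bool" where
  "in_bigo s g \<longleftrightarrow> (\<forall>n. s n \<noteq> \<infinity>) \<and> (\<lambda>n. real (the_enat (s n))) \<in> O(g)"

definition in_bigtheta :: "(nat \<Rightarrow> enat) \<Rightarrow> (nat \<Rightarrow> real) \<Rightarrow> bool" where
  "in_bigtheta s g \<longleftrightarrow> (\<forall>n. s n \<noteq> \<infinity>) \<and> (\<lambda>n. real (the_enat (s n))) \<in> \<Theta>(g)"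

text \<open>Unlike the library's \<open>o(g)\<close>, this uses a strict inequality; the two agree whenever \<open>g\<close> is
  eventually positive.\<close>

definition in_smallo :: "(nat \<Rightarrow> enat) \<Rightarrow> (nat \<Rightarrow> real) \<Rightarrow> bool" where
  "in_smallo s g \<longleftrightarrow> (\<forall>n. s n \<noteq> \<infinity>) \<and>
     (\<forall>c>0. \<exists>n0. \<forall>n>n0. real (the_enat (s n)) < c * g n)"


section \<open>The three possible growth behaviours\<close>

definition unlimited_case :: "measure_kind \<Rightarrow> ('q, 'a, 'g) sa \<Rightarrow> bool" where
  "unlimited_case z M \<longleftrightarrow> unlimited z M \<and> \<not> (\<exists>f. in_bigo (length_space z M) f)"

definition constant_case :: "measure_kind \<Rightarrow> ('q, 'a, 'g) sa \<Rightarrow> bool" where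
  "constant_case z M \<longleftrightarrow> limited z M \<and> in_bigo (length_space z M) (\<lambda>n. 1) \<and>
     regular_language (input_alph M) (accepted_language M)"

definition linear_case :: "measure_kind \<Rightarrow> ('q, 'a, 'g) sa \<Rightarrow> bool" where
  "linear_case z M \<longleftrightarrow> limited z M \<and> in_bigo (length_space z M) (\<lambda>n. real n) \<and>
     \<not> in_smallo (length_space z M) (\<lambda>n. real n) \<and> in_bigtheta (space_upto z M) (\<lambda>n. real n)"

end

(*
A computation of a checking stack automaton writes a word w on the stack and then moves as a
two-way automaton on the fixed tape formed by w. Call a stack position marked if an input letter is
consumed when it is pushed or while the head scans it, or if reading starts or ends there. There
are at most |u| + 2 marked positions. If |w| is much larger than |u|, then w contains a long
unmarked block; by the pigeonhole principle the block has a nonempty prefix x and a longer prefix xy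
such that the writing automaton is in the same situation after x and after xy, and such that x and
xy induce the same relation between entries and exits of the head by moves without input. Replacing
x by xy lengthens the stack by a bounded amount and keeps the input. Hence an automaton with finite
space measure uses at most linear space.

Conversely, for a fixed stack word w some computation visits each combination of state and head
position only boundedly often, so it consumes at most O(|w|) letters; and pumping with all labels
erased shows that the attained stack sizes have bounded gaps if they are unbounded. This gives the
linear lower bound. If the sizes are bounded, then only finitely many stack contents occur, the
language has finitely many residuals and is regular.
*)

theory Submission
  imports Defs "HOL-Library.Sublist"
begin

section \<open>Labelled paths\<close>

text \<open>Both measures are treated at once because a non-erasing stack never shrinks: the size of
  a computation is that of its last configuration, and the measures differ only in which last
  configurations count. Pumping goes upwards only: a finite set of sizes has a maximum, and one more
  pumping step would exceed it. The obstacle is that the reading phase is two-way. A factor of the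
  tape may be visited many times, so no single cut of the run exchanges it; equal behaviour replaces
  all visits simultaneously. Behaviours record states and ends but no input, which is why the factor
  has to avoid the cells where letters are read. Replacing \<open>x\<close> by \<open>xy\<close>
  inside \<open>xyz\<close> leaves the context to the right untouched, so only prefixes of one block
  have to be compared. For the lower bound a linear relation between size and input length already
  refutes \<open>o(n)\<close>, even along a sparse sequence. The Theta bound for
  \<open>space_upto\<close> also needs control of the gaps between attained sizes. Pumping at fixed
  input cannot give it, because its threshold grows with the input; after erasing all labels the
  threshold is a constant.\<close>

inductive lpath :: "('c \<Rightarrow> 'a option \<Rightarrow> 'c \<Rightarrow> bool) \<Rightarrow> 'c \<Rightarrow> 'a list \<Rightarrow> 'c \<Rightarrow> bool"
  for E where
  nil: "lpath E c [] c"
| cons: "E c a c1 \<Longrightarrow> lpath E c1 u c2 \<Longrightarrow> lpath E c (consumed a @ u) c2"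

lemma lpath_append:
  assumes "lpath E c u c1" "lpath E c1 v c2"
  shows "lpath E c (u @ v) c2"
  using assms by induction (auto intro: lpath.intros)

lemma lpath_single: "E c a c1 \<Longrightarrow> lpath E c (consumed a) c1"
  using lpath.cons[OF _ lpath.nil, of E c a c1] by simp

lemma lpath_snoc:
  assumes "lpath E c u c1" "E c1 a c2"
  shows "lpath E c (u @ consumed a) c2"
  using assms by (blast intro: lpath_append lpath_single)

text \<open>One edge reads at most one letter, so the boundary between \<open>u\<close> and
  \<open>v\<close> never falls inside an edge.\<close>

lemma lpath_split:
  assumes "lpath E c (u @ v) c2"
  obtains c1 where "lpath E c u c1" "lpath E c1 v c2"
proof -
  have "\<exists>c1. lpath E c u c1 \<and> lpath E c1 v c2" if "lpath E c w c2" "w = u @ v" for w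
    using that
  proof (induction arbitrary: u)
    case (nil c)
    then show ?case by (auto intro: lpath.nil)
  next
    case (cons c a c1 w' c2)
    show ?case
    proof (cases a)
      case None
      then show ?thesis
        using cons by (metis append_Nil consumed.simps(1) lpath.cons)
    next
      case (Some b)
      show ?thesis
      proof (cases u)
        case Nil
        then show ?thesis
          using cons by (metis append_Nil lpath.cons lpath.nil)
      next
        case (Cons b' u')
        with cons Some obtain c3 where "b' = b" "lpath E c1 u' c3" "lpath E c3 v c2"
          by auto
        then show ?thesis
          using cons.hyps(1) Some Cons lpath.cons[of E c a c1 u' c3] by auto
      qed
    qed
  qed
  then show thesis using assms that by blast
qed

lemma lpath_mono:
  assumes "lpath E c u c'" "\<And>c a c'. E c a c' \<Longrightarrow> E' c a c'"
  shows "lpath E' c u c'"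
  using assms by induction (auto intro: lpath.intros)

lemma lpath_invariant:
  assumes "lpath E c u c'" "P c" "\<And>c a c'. P c \<Longrightarrow> E c a c' \<Longrightarrow> P c'"
  shows "P c'"
  using assms by induction auto

lemma lpath_imp_rtrancl:
  "lpath E c u c' \<Longrightarrow> (c, c') \<in> {(c, c'). \<exists>a. E c a c'}\<^sup>*"
  by (induction rule: lpath.induct) (auto intro: converse_rtrancl_into_rtrancl)

lemma length_consumed: "length (consumed a) \<le> 1"
  by (cases a) auto

lemma relpow_imp_lpath:
  "(c, c') \<in> {(c, c'). \<exists>a. E c a c'} ^^ n \<Longrightarrow> \<exists>u. length u \<le> n \<and> lpath E c u c'"
proof (induction n arbitrary: c')
  case 0
  then show ?case by (auto intro: lpath.nil)
next
  case (Suc n)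
  then obtain c1 a where "(c, c1) \<in> {(c, c'). \<exists>a. E c a c'} ^^ n" and e: "E c1 a c'"
    by auto
  then obtain u where "length u \<le> n" "lpath E c u c1"
    using Suc.IH by blast
  moreover from this e have "lpath E c (u @ consumed a) c'"
    by (blast intro: lpath_snoc)
  ultimately show ?case
    using length_consumed[of a] by (intro exI[of _ "u @ consumed a"]) auto
qed

text \<open>Only reachability is kept, not the word: in a finite relation a connection exists within
  \<open>card R\<close> steps, and each step reads at most one letter. The new word may be unrelated
  to \<open>u\<close>.\<close>

lemma lpath_shorten:
  assumes "lpath E c u c'" and "finite R" and "\<And>c a c'. E c a c' \<Longrightarrow> (c, c') \<in> R"
  obtains u' where "length u' \<le> card R" "lpath E c u' c'"
proof -
  let ?R = "{(c, c'). \<exists>a. E c a c'}"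
  have sub: "?R \<subseteq> R" using assms(3) by auto
  then have fin: "finite ?R" using assms(2) by (rule finite_subset)
  have "(c, c') \<in> ?R\<^sup>*" using assms(1) by (rule lpath_imp_rtrancl)
  then obtain n where n: "n \<le> card ?R" "(c, c') \<in> ?R ^^ n"
    unfolding rtrancl_finite_eq_relpow[OF fin] by blast
  obtain u' where "length u' \<le> n" "lpath E c u' c'"
    using relpow_imp_lpath[OF n(2)] by blast
  moreover have "n \<le> card R"
    using n(1) card_mono[OF assms(2) sub] by linarith
  ultimately show thesis using that[of u'] by linarith
qed

text \<open>\<open>N\<close> consists of the configurations in which the given path reads a letter,
  at most one for each letter. Restricting the edge relation this way fixes where input is read
  without carrying the path itself along.\<close>

lemma lpath_mark:
  assumes "lpath E c u c'"
  obtains N where "finite N" "card N \<le> length u"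
    "lpath (\<lambda>c a c'. E c a c' \<and> (a = None \<or> c \<in> N)) c u c'"
proof -
  have "\<exists>N. finite N \<and> card N \<le> length u \<and>
          lpath (\<lambda>c a c'. E c a c' \<and> (a = None \<or> c \<in> N)) c u c'"
    using assms
  proof induction
    case (nil c)
    show ?case by (intro exI[of _ "{}"]) (auto intro: lpath.nil)
  next
    case (cons c a c1 u c2)
    then obtain N where N: "finite N" "card N \<le> length u"
      "lpath (\<lambda>c a c'. E c a c' \<and> (a = None \<or> c \<in> N)) c1 u c2" by blast
    let ?N = "if a = None then N else insert c N"
    have "lpath (\<lambda>c a c'. E c a c' \<and> (a = None \<or> c \<in> ?N)) c1 u c2"
      using N(3) by (rule lpath_mono) auto
    moreover have "E c a c1 \<and> (a = None \<or> c \<in> ?N)"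
      using cons.hyps(1) by auto
    ultimately have "lpath (\<lambda>c a c'. E c a c' \<and> (a = None \<or> c \<in> ?N)) c (consumed a @ u) c2"
      using lpath.cons[of "\<lambda>c a c'. E c a c' \<and> (a = None \<or> c \<in> ?N)" c a c1] by blast
    moreover have "finite ?N" using N by simp
    moreover have "card ?N \<le> length (consumed a @ u)"
      using N card_insert_le_m1[of "Suc (length u)" N c] by (cases a) auto
    ultimately show ?case by blast
  qed
  then show thesis using that by blast
qed

lemma lpath_erase:
  "lpath (\<lambda>c a c'. a = None \<and> (\<exists>b. E c b c')) c [] c' \<longleftrightarrow> (\<exists>u. lpath E c u c')"
proof
  show "\<exists>u. lpath E c u c'"
    if "lpath (\<lambda>c a c'. a = None \<and> (\<exists>b. E c b c')) c [] c'"
  proof -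
    have "\<exists>u. lpath E c u c'" if "lpath (\<lambda>c a c'. a = None \<and> (\<exists>b. E c b c')) c v c'" for v
      using that by induction (blast intro: lpath.intros)+
    then show ?thesis using that by blast
  qed
next
  assume "\<exists>u. lpath E c u c'"
  then obtain u where "lpath E c u c'" by blast
  then show "lpath (\<lambda>c a c'. a = None \<and> (\<exists>b. E c b c')) c [] c'"
  proof induction
    case (nil c)
    show ?case by (rule lpath.nil)
  next
    case (cons c a c1 u c2)
    then show ?case
      using lpath.cons[of "\<lambda>c a c'. a = None \<and> (\<exists>b. E c b c')" c None c1 "[]" c2] by auto
  qed
qed

text \<open>Paths are built from their first edge, whereas invariants of a run speak about what has
  been reached from the start. The part already read is carried along as \<open>v\<close>.\<close>

lemma lpath_snoc_induct [consumes 1, case_names nil snoc]: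
  assumes "lpath E c u c'" and "P [] c"
    and "\<And>u c1 a c2. lpath E c u c1 \<Longrightarrow> P u c1 \<Longrightarrow> E c1 a c2 \<Longrightarrow> P (u @ consumed a) c2"
  shows "P u c'"
proof -
  have "P (v @ u) c'" if "lpath E c1 u c'" "lpath E c v c1" "P v c1" for c1 v u c'
    using that
  proof (induction arbitrary: v)
    case (nil c1)
    then show ?case by simp
  next
    case (cons c1 a c2 u c3)
    have "P ((v @ consumed a) @ u) c3"
    proof (rule cons.IH)
      show "lpath E c (v @ consumed a) c2" using cons.prems(1) cons.hyps(1) by (rule lpath_snoc)
      show "P (v @ consumed a) c2" using cons.prems cons.hyps(1) by (rule assms(3))
    qed
    then show ?case by simp
  qed
  from this[OF assms(1) lpath.nil assms(2)] show ?thesis by simp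
qed

lemma lpath_lists:
  assumes "lpath E c u c'" "\<And>c a c'. E c a c' \<Longrightarrow> set (consumed a) \<subseteq> A"
  shows "u \<in> lists A"
  using assms
proof induction
  case (cons c a c1 u c2)
  then have "set (consumed a) \<subseteq> A" "u \<in> lists A" by blast+
  then show ?case by auto
qed simp


section \<open>The writing and the reading phase\<close>

definition top_sym :: "'g list \<Rightarrow> 'g stack_symbol" where
  "top_sym w = last (Bottom # map Sym w)"

lemma top_sym_simps [simp]: "top_sym [] = Bottom" "top_sym (w @ [y]) = Sym y"
  by (auto simp: top_sym_def)

definition tape :: "'g list \<Rightarrow> 'g stack_symbol list" where
  "tape w = Bottom # map Sym w @ [Top]"

type_synonym ('q, 'a, 'g) transitions =
  "(('q \<times> 'a option \<times> 'g stack_symbol) \<times> ('q \<times> 'g stack_instr)) set"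

text \<open>The end markers are fixed during writing, so a configuration keeps only the word between
  them; it grows at the right end.\<close>

inductive wstep :: "('q, 'a, 'g) transitions \<Rightarrow> 'q \<times> 'g list \<Rightarrow> 'a option \<Rightarrow> 'q \<times> 'g list \<Rightarrow> bool"
  for D where
  stay: "((q, a, top_sym w), (p, Stay)) \<in> D \<Longrightarrow> wstep D (q, w) a (p, w)"
| push: "((q, a, top_sym w), (p, Push y)) \<in> D \<Longrightarrow> wstep D (q, w) a (p, w @ [y])"

definition moves :: "('g stack_instr \<times> int) set" where
  "moves = {(Down, -1), (Hold, 0), (Up, 1)}"

text \<open>Head positions are integers, so that leaving a factor of the tape to the left is the
  position \<open>-1\<close> relative to that factor.\<close>

definition rstep ::
    "('q, 'a, 'g) transitions \<Rightarrow> 'g stack_symbol list \<Rightarrow> 'q \<times> int \<Rightarrow> 'a option \<Rightarrow> 'q \<times> int \<Rightarrow> bool"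
  where
  "rstep D t c a c' \<longleftrightarrow>
     0 \<le> snd c \<and> snd c < int (length t) \<and> 0 \<le> snd c' \<and> snd c' < int (length t) \<and>
     (\<exists>i. ((fst c, a, t ! nat (snd c)), (fst c', i)) \<in> D \<and> (i, snd c' - snd c) \<in> moves)"

lemma length_tape [simp]: "length (tape w) = length w + 2"
  by (simp add: tape_def)

lemma lpath_wstep_prefix:
  "lpath (wstep D) c u c' \<Longrightarrow> prefix (snd c) (snd c')"
proof (induction rule: lpath.induct)
  case (cons c a c1 u c2)
  from cons.hyps(1) have "prefix (snd c) (snd c1)"
    by cases auto
  from this cons.IH show ?case by (rule prefix_order.trans)
qed simp

text \<open>A write step inspects only the topmost symbol, and nothing below the current height is
  ever uncovered. Hence \<open>v\<close> can be exchanged for any word with the same top.\<close>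

lemma lpath_wstep_rebase:
  assumes "lpath (wstep D) (p, v) u (q, v @ r)" "top_sym v = top_sym v'"
  shows "lpath (wstep D) (p, v') u (q, v' @ r)"
proof -
  have "lpath (wstep D) (fst c, v') u (fst c', v' @ r)"
    if "lpath (wstep D) c u c'" "snd c' = snd c @ r" "top_sym (snd c) = top_sym v'" for c c' v' r
    using that
  proof (induction arbitrary: v' r)
    case (nil c)
    then show ?case by (auto intro: lpath.nil)
  next
    case (cons c a c1 u c2)
    from cons.hyps(1) show ?case
    proof cases
      case (stay q w p)
      then have "lpath (wstep D) (fst c1, v') u (fst c2, v' @ r)"
        using cons.IH cons.prems by simp
      moreover have "wstep D (fst c, v') a (fst c1, v')"
        using stay cons.prems by (auto intro: wstep.stay)
      ultimately show ?thesis by (blast intro: lpath.cons)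
    next
      case (push q w p y)
      have "prefix (snd c1) (snd c2)" using cons.hyps(2) by (rule lpath_wstep_prefix)
      with push cons.prems obtain r' where r: "r = y # r'"
        by (auto simp: prefix_def)
      have "lpath (wstep D) (fst c1, v' @ [y]) u (fst c2, (v' @ [y]) @ r')"
        using push cons.prems r by (intro cons.IH) auto
      moreover have "wstep D (fst c, v') a (fst c1, v' @ [y])"
        using push cons.prems by (auto intro: wstep.push)
      ultimately show ?thesis using r by (auto intro: lpath.cons)
    qed
  qed
  from this[OF assms(1)] assms(2) show ?thesis by simp
qed

text \<open>Heights never decrease, so the run is cut at the moments when a new height is reached.
  \<open>qs k\<close> is the state at the arrival \<open>k\<close> symbols above \<open>v\<close>,
  and \<open>us k\<close> is what is read from then on up to and including the next push, or up to
  the end for the last index.\<close>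

lemma lpath_wstep_heights:
  assumes "lpath (wstep D) (p, v) u (q, v @ r)"
  obtains qs us where "qs 0 = p" "u = concat (map us [0..<Suc (length r)])"
    "\<And>k. k < length r \<Longrightarrow> lpath (wstep D) (qs k, v @ take k r) (us k) (qs (Suc k), v @ take (Suc k) r)"
    "lpath (wstep D) (qs (length r), v @ r) (us (length r)) (q, v @ r)"
proof -
  have "\<exists>qs us. qs 0 = fst c \<and> u = concat (map us [0..<Suc (length r)]) \<and>
     (\<forall>k < length r. lpath (wstep D) (qs k, snd c @ take k r) (us k) (qs (Suc k), snd c @ take (Suc k) r))
     \<and> lpath (wstep D) (qs (length r), snd c @ r) (us (length r)) c'"
    if "lpath (wstep D) c u c'" "snd c' = snd c @ r" for c c' r
    using that
  proof (induction arbitrary: r)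
    case (nil c)
    then show ?case
      by (intro exI[of _ "\<lambda>_. fst c"] exI[of _ "\<lambda>_. []"]) (auto intro: lpath.nil)
  next
    case (cons c a c1 u c2)
    from cons.hyps(1) show ?case
    proof cases
      case (stay q w p)
      then obtain qs us where *: "qs 0 = p" "u = concat (map us [0..<Suc (length r)])"
         "\<forall>k < length r. lpath (wstep D) (qs k, w @ take k r) (us k) (qs (Suc k), w @ take (Suc k) r)"
         "lpath (wstep D) (qs (length r), w @ r) (us (length r)) c2"
        using cons.IH[of r] cons.prems by auto
      \<comment> \<open>A stay step leaves the height unchanged, so it is absorbed into the piece
        with index 0.\<close>
      let ?qs = "qs(0 := q)" and ?us = "us(0 := consumed a @ us 0)"
      have st: "wstep D (q, w) a (p, w)" using cons.hyps(1) stay by simp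
      have u': "consumed a @ u = concat (map ?us [0..<Suc (length r)])"
        unfolding *(2) by (simp add: upt_rec[of 0] del: upt_Suc)
      have "lpath (wstep D) (?qs k, w @ take k r) (?us k) (?qs (Suc k), w @ take (Suc k) r)"
        if "k < length r" for k
      proof (cases k)
        case 0
        then show ?thesis using *(1,3) that st lpath.cons[of "wstep D", OF st] by auto
      next
        case (Suc k')
        then show ?thesis using *(3) that by auto
      qed
      moreover have "lpath (wstep D) (?qs (length r), w @ r) (?us (length r)) c2"
        using *(1,4) lpath.cons[of "wstep D", OF st] by (cases r) auto
      ultimately show ?thesis
        using stay u' by (intro exI[of _ ?qs] exI[of _ ?us]) (simp add: fun_upd_def del: upt_Suc)
    next
      case (push q w p y)
      have "prefix (snd c1) (snd c2)" using cons.hyps(2) by (rule lpath_wstep_prefix)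
      with push cons.prems obtain r' where r: "r = y # r'"
        by (auto simp: prefix_def)
      then obtain qs us where *: "qs 0 = p" "u = concat (map us [0..<Suc (length r')])"
         "\<forall>k < length r'. lpath (wstep D) (qs k, (w @ [y]) @ take k r') (us k) (qs (Suc k), (w @ [y]) @ take (Suc k) r')"
         "lpath (wstep D) (qs (length r'), (w @ [y]) @ r') (us (length r')) c2"
        using cons.IH[of r'] cons.prems push by auto
      \<comment> \<open>A push completes the piece with index 0; the pieces of the remaining run
        move up by one index.\<close>
      let ?qs = "case_nat q qs" and ?us = "case_nat (consumed a) us"
      have st: "wstep D (q, w) a (p, w @ [y])" using cons.hyps(1) push by simp
      have "map ?us (map Suc [0..<Suc (length r')]) = map us [0..<Suc (length r')]"
        by (simp del: upt_Suc)
      then have u': "consumed a @ u = concat (map ?us [0..<Suc (length r)])"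
        unfolding *(2) map_Suc_upt using r by (simp add: upt_rec[of 0] del: upt_Suc)
      have "lpath (wstep D) (?qs k, w @ take k r) (?us k) (?qs (Suc k), w @ take (Suc k) r)"
        if "k < length r" for k
      proof (cases k)
        case 0
        then show ?thesis using *(1) lpath_single[of "wstep D", OF st] r by auto
      next
        case (Suc k')
        then show ?thesis using *(3) that r by auto
      qed
      moreover have "lpath (wstep D) (?qs (length r), w @ r) (?us (length r)) c2"
        using *(4) r by auto
      ultimately show ?thesis
        using push u' by (intro exI[of _ ?qs] exI[of _ ?us]) auto
    qed
  qed
  from this[OF assms] that show thesis by auto
qed

section \<open>Pumping the stack contents\<close>

text \<open>Only the source has to lie inside the factor. The target may lie one cell outside, and
  such a step is an exit: no inner step starts there.\<close>

definition inner_step ::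
    "('q, 'a, 'g) transitions \<Rightarrow> 'g stack_symbol list \<Rightarrow> 'q \<times> int \<Rightarrow> 'q \<times> int \<Rightarrow> bool" where
  "inner_step D x c c' \<longleftrightarrow>
     0 \<le> snd c \<and> snd c < int (length x) \<and>
     (\<exists>i. ((fst c, None, x ! nat (snd c)), (fst c', i)) \<in> D \<and> (i, snd c' - snd c) \<in> moves)"

text \<open>The Boolean components select the left end of the factor; the head leaves a factor \<open>x\<close>
  at the positions \<open>-1\<close> or \<open>length x\<close>.\<close>

definition behaviour ::
    "('q, 'a, 'g) transitions \<Rightarrow> 'g stack_symbol list \<Rightarrow> ('q \<times> bool \<times> 'q \<times> bool) set" where
  "behaviour D x = {(p, d, q, e). (inner_step D x)\<^sup>*\<^sup>*
     (p, if d then 0 else int (length x) - 1) (q, if e then -1 else int (length x))}"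

lemma moves_bound: "(i, d) \<in> moves \<Longrightarrow> -1 \<le> d \<and> d \<le> 1"
  by (auto simp: moves_def)

text \<open>This leaves finitely many behaviours when \<open>Q\<close> is finite. In a nonempty
  factor the entry cell differs from the exit position, so at least one step is made, and that puts
  both states into \<open>Q\<close>.\<close>

lemma behaviour_subset:
  assumes "D \<subseteq> (Q \<times> UNIV) \<times> Q \<times> UNIV" "x \<noteq> []"
  shows "behaviour D x \<subseteq> Q \<times> UNIV \<times> Q \<times> UNIV"
proof -
  have "fst c \<in> Q \<and> fst c' \<in> Q" if "(inner_step D x)\<^sup>*\<^sup>* c c'" "snd c \<noteq> snd c'" for c c'
  proof -
    from that have "(inner_step D x)\<^sup>+\<^sup>+ c c'" by (metis rtranclpD)
    then obtain c1 c2 where "inner_step D x c c1" "inner_step D x c2 c'"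
      by (metis tranclpD tranclp.cases)
    then show ?thesis using assms(1) by (auto simp: inner_step_def)
  qed
  from this[of "(_, _)" "(_, _)"] assms(2) show ?thesis
    by (fastforce simp: behaviour_def split: if_splits)
qed

text \<open>The contexts are nonempty, so the exit positions on either side of the factor are still
  cells of the tape.\<close>

lemma inner_steps_lpath:
  assumes "(inner_step D x)\<^sup>*\<^sup>* c c'" and "\<alpha> \<noteq> []" "\<beta> \<noteq> []"
  shows "lpath (rstep D (\<alpha> @ x @ \<beta>)) (fst c, int (length \<alpha>) + snd c) []
           (fst c', int (length \<alpha>) + snd c')"
  using assms(1)
proof (induction rule: converse_rtranclp_induct)
  case base
  show ?case by (rule lpath.nil)
next
  case (step c c1)
  from step.hyps(1) obtain i where
    s: "0 \<le> snd c" "snd c < int (length x)"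
      "((fst c, None, x ! nat (snd c)), (fst c1, i)) \<in> D" "(i, snd c1 - snd c) \<in> moves"
    by (auto simp: inner_step_def)
  have "(\<alpha> @ x @ \<beta>) ! nat (int (length \<alpha>) + snd c) = x ! nat (snd c)"
    using s(1,2) by (simp add: nth_append nat_add_distrib nat_less_iff)
  moreover have "0 < int (length \<alpha>)" "0 < int (length \<beta>)" using assms by auto
  then have "0 \<le> int (length \<alpha>) + snd c1" "int (length \<alpha>) + snd c1 < int (length (\<alpha> @ x @ \<beta>))"
    using s(1,2) moves_bound[OF s(4)] unfolding length_append of_nat_add by linarith+
  ultimately have "rstep D (\<alpha> @ x @ \<beta>) (fst c, int (length \<alpha>) + snd c) None
      (fst c1, int (length \<alpha>) + snd c1)"
    using s by (auto simp: rstep_def intro!: exI[of _ i])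
  from lpath.cons[of "rstep D (\<alpha> @ x @ \<beta>)", OF this step.IH] show ?case by simp
qed

text \<open>The run alternates between stretches outside the factor, which are copied with shifted
  positions, and excursions into it. An excursion reads no input and enters and leaves at the ends
  of the factor, so it is an element of \<open>behaviour D x\<close> and has a counterpart in
  \<open>x'\<close> with the same states and ends.\<close>

lemma replace_factor:
  fixes D :: "('q, 'a, 'g) transitions" and \<alpha> \<beta> x x' :: "'g stack_symbol list"
  defines "inside \<equiv> {int (length \<alpha>)..<int (length \<alpha>) + int (length x)}"
    and "shift \<equiv> \<lambda>i. if i < int (length \<alpha>) then i else i + int (length x') - int (length x)"
  assumes beh: "behaviour D x = behaviour D x'"
    and ne: "x \<noteq> []" "x' \<noteq> []" "\<alpha> \<noteq> []" "\<beta> \<noteq> []"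
    and path: "lpath (\<lambda>c a c'. rstep D (\<alpha> @ x @ \<beta>) c a c' \<and> (a = None \<or> snd c \<notin> inside)) c u c'"
    and out: "snd c \<notin> inside" "snd c' \<notin> inside"
  shows "lpath (rstep D (\<alpha> @ x' @ \<beta>)) (fst c, shift (snd c)) u (fst c', shift (snd c'))"
proof -
  let ?A = "int (length \<alpha>)" and ?X = "int (length x)" and ?X' = "int (length x')"
  let ?t = "\<alpha> @ x @ \<beta>" and ?t' = "\<alpha> @ x' @ \<beta>"
  have pos: "0 < ?A" "0 < ?X" "0 < ?X'" using ne by auto
  have nth_shift: "?t' ! nat (shift i) = ?t ! nat i" if "i \<notin> inside" "0 \<le> i" for i
  proof (cases "i < ?A")
    case True
    then show ?thesis using that by (simp add: shift_def nth_append nat_less_iff)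
  next
    case False
    then have i: "?A + ?X \<le> i" using that by (auto simp: inside_def)
    define k where "k = nat (i - ?A - ?X)"
    have "i = ?A + ?X + int k" using i by (simp add: k_def)
    then have "nat i = length \<alpha> + (length x + k)" "nat (shift i) = length \<alpha> + (length x' + k)"
      by (auto simp: shift_def)
    then show ?thesis by (simp add: nth_append)
  qed
  have exit_shift: "shift (if e then ?A - 1 else ?A + ?X) = (if e then ?A - 1 else ?A + ?X')" for e
    by (simp add: shift_def)
  have outer: "rstep D ?t' (fst c, shift (snd c)) a (fst c1, shift (snd c1))"
    if "rstep D ?t c a c1" "snd c \<notin> inside" "snd c1 \<notin> inside" for c a c1
  proof -
    from that(1) obtain i where i: "((fst c, a, ?t ! nat (snd c)), (fst c1, i)) \<in> D"
      "(i, snd c1 - snd c) \<in> moves" and r: "0 \<le> snd c" "snd c < int (length ?t)"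
      "0 \<le> snd c1" "snd c1 < int (length ?t)"
      by (auto simp: rstep_def)
    \<comment> \<open>The factor is nonempty and a move has width at most 1, so a step between two
      outer cells cannot jump across the factor; both cells are shifted alike.\<close>
    have "shift (snd c1) - shift (snd c) = snd c1 - snd c"
      using moves_bound[OF i(2)] that(2,3) pos
      unfolding shift_def inside_def atLeastLessThan_iff by (smt (verit))
    moreover have "0 \<le> shift (snd c)" "shift (snd c) < int (length ?t')"
      "0 \<le> shift (snd c1)" "shift (snd c1) < int (length ?t')"
      using r that(2,3) pos by (auto simp: shift_def inside_def)
    ultimately show ?thesis
      using i nth_shift[OF that(2) r(1)] unfolding rstep_def by auto
  qed
  \<comment> \<open>Induction from the front also meets runs that begin inside the factor. For these
    the claim splits the run: inner steps on the old factor up to an exit \<open>(q, e)\<close>, and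
    from that exit a run that is already transferred to the new tape. The excursion itself is
    exchanged only when its entry is met.\<close>
  have key: "(snd c \<notin> inside \<longrightarrow> lpath (rstep D ?t') (fst c, shift (snd c)) u (fst c', shift (snd c')))
     \<and> (snd c \<in> inside \<longrightarrow> (\<exists>q e. (inner_step D x)\<^sup>*\<^sup>* (fst c, snd c - ?A) (q, if e then -1 else ?X) \<and>
          lpath (rstep D ?t') (q, if e then ?A - 1 else ?A + ?X') u (fst c', shift (snd c'))))"
    using path out(2)
  proof induction
    case (nil c)
    then show ?case by (auto intro: lpath.nil)
  next
    case (cons c a c1 u c2)
    from cons.hyps(1) have st: "rstep D ?t c a c1" and mark: "a = None \<or> snd c \<notin> inside" by auto
    from st obtain i where i: "((fst c, a, ?t ! nat (snd c)), (fst c1, i)) \<in> D"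
      "(i, snd c1 - snd c) \<in> moves" and r: "0 \<le> snd c" "snd c < int (length ?t)"
      "0 \<le> snd c1" "snd c1 < int (length ?t)"
      by (auto simp: rstep_def)
    note IH = cons.IH[OF cons.prems]
    note mb = moves_bound[OF i(2)]
    show ?case
    proof (cases "snd c \<in> inside")
      case False
      have "lpath (rstep D ?t') (fst c, shift (snd c)) (consumed a @ u) (fst c2, shift (snd c2))"
      proof (cases "snd c1 \<in> inside")
        case out1: False
        with IH outer[OF st False] show ?thesis by (blast intro: lpath.cons)
      next
        case in1: True
        then obtain q e where
          ex: "(inner_step D x)\<^sup>*\<^sup>* (fst c1, snd c1 - ?A) (q, if e then -1 else ?X)"
            "lpath (rstep D ?t') (q, if e then ?A - 1 else ?A + ?X') u (fst c2, shift (snd c2))"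
          using IH by blast
        \<comment> \<open>Moves have width at most 1, so an excursion enters at the first cell from
          the left or at the last cell from the right.\<close>
        define d where "d \<longleftrightarrow> snd c < ?A"
        have c1: "snd c1 - ?A = (if d then 0 else ?X - 1)"
          and c: "snd c = (if d then ?A - 1 else ?A + ?X)"
          using False in1 mb by (auto simp: d_def inside_def)
        have "(fst c1, d, q, e) \<in> behaviour D x"
          using ex(1) unfolding behaviour_def c1 by auto
        then have "(inner_step D x')\<^sup>*\<^sup>* (fst c1, if d then 0 else ?X' - 1) (q, if e then -1 else ?X')"
          unfolding beh by (simp add: behaviour_def)
        from inner_steps_lpath[OF this ne(3,4)]
        have "lpath (rstep D ?t') (fst c1, ?A + (if d then 0 else ?X' - 1)) []
            (q, if e then ?A - 1 else ?A + ?X')"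
          by (auto split: if_splits)
        from lpath_append[OF this ex(2)]
        have "lpath (rstep D ?t') (fst c1, ?A + (if d then 0 else ?X' - 1)) u (fst c2, shift (snd c2))"
          by simp
        moreover have "rstep D ?t' (fst c, shift (snd c)) a (fst c1, ?A + (if d then 0 else ?X' - 1))"
        proof -
          have "shift (snd c) = (if d then ?A - 1 else ?A + ?X')"
            unfolding c by (rule exit_shift)
          then have "?A + (if d then 0 else ?X' - 1) - shift (snd c) = snd c1 - snd c"
            using c c1 by (auto split: if_splits)
          moreover have "0 \<le> shift (snd c)" "shift (snd c) < int (length ?t')"
            using r False pos by (auto simp: shift_def inside_def)
          moreover have "0 \<le> ?A + (if d then 0 else ?X' - 1)"
            "?A + (if d then 0 else ?X' - 1) < int (length ?t')"
            using pos unfolding length_append of_nat_add by (cases d; simp only: if_True if_False; linarith)+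
          ultimately show ?thesis
            using i nth_shift[OF False r(1)] unfolding rstep_def by auto
        qed
        ultimately show ?thesis by (rule lpath.cons[rotated])
      qed
      with False show ?thesis by simp
    next
      case True
      with mark have a: "a = None" by simp
      have sym: "?t ! nat (snd c) = x ! nat (snd c - ?A)"
        using True by (auto simp: inside_def nth_append nat_less_iff nat_diff_distrib)
      have inner: "inner_step D x (fst c, snd c - ?A) (fst c1, snd c1 - ?A)"
        using i True unfolding inner_step_def sym a by (auto simp: inside_def)
      show ?thesis
      proof (cases "snd c1 \<in> inside")
        case in1: True
        then obtain q e where
          ex: "(inner_step D x)\<^sup>*\<^sup>* (fst c1, snd c1 - ?A) (q, if e then -1 else ?X)"
            "lpath (rstep D ?t') (q, if e then ?A - 1 else ?A + ?X') u (fst c2, shift (snd c2))"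
          using IH by blast
        have "\<exists>q e. (inner_step D x)\<^sup>*\<^sup>* (fst c, snd c - ?A) (q, if e then -1 else ?X) \<and>
            lpath (rstep D ?t') (q, if e then ?A - 1 else ?A + ?X') u (fst c2, shift (snd c2))"
          using converse_rtranclp_into_rtranclp[of "inner_step D x", OF inner ex(1)] ex(2) by blast
        with True a show ?thesis by simp
      next
        case out1: False
        define e where "e \<longleftrightarrow> snd c1 < ?A"
        have c1: "snd c1 = (if e then ?A - 1 else ?A + ?X)"
          using out1 True mb by (auto simp: e_def inside_def)
        have "lpath (rstep D ?t') (fst c1, if e then ?A - 1 else ?A + ?X') u (fst c2, shift (snd c2))"
          using IH out1 exit_shift[of e] unfolding c1 by simp
        moreover have "(inner_step D x)\<^sup>*\<^sup>* (fst c, snd c - ?A) (fst c1, if e then -1 else ?X)"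
          using inner unfolding c1 by (auto split: if_splits)
        ultimately show ?thesis
          using True a by (auto intro!: exI[of _ "fst c1"] exI[of _ e])
      qed
    qed
  qed
  then show ?thesis using out(1) by simp
qed

section \<open>Finding and pumping an unmarked block\<close>

text \<open>The \<open>m\<close> blocks are disjoint, so fewer than \<open>m\<close> marks cannot
  meet all of them. Blocks begin at cell 1 because cell 0 of a tape holds
  \<open>Bottom\<close>.\<close>

lemma unmarked_block:
  fixes N :: "nat set"
  assumes "finite N" "card N < m" "K > 0"
  obtains b where "b < m" "N \<inter> {Suc (b * K)..b * K + K} = {}"
proof (rule ccontr)
  assume no: "\<not> thesis"
  have "{..<m} \<subseteq> (\<lambda>p. (p - 1) div K) ` N"
  proof
    fix b assume "b \<in> {..<m}"
    with no that obtain p where p: "p \<in> N" "Suc (b * K) \<le> p" "p \<le> b * K + K" by fastforce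
    have "(p - 1) div K = b"
      using p(2,3) assms(3) by (intro div_nat_eqI) (auto simp: mult.commute)
    with p(1) show "b \<in> (\<lambda>p. (p - 1) div K) ` N" by force
  qed
  then have "card {..<m} \<le> card N"
    using surj_card_le[OF assms(1)] by blast
  with assms(2) show False by simp
qed

lemma card_nonempty_le_length_concat:
  "card {k. k < n \<and> us k \<noteq> []} \<le> length (concat (map us [0..<n]))"
proof (induction n)
  case 0
  show ?case by simp
next
  case (Suc n)
  have "{k. k < Suc n \<and> us k \<noteq> []} = (if us n = [] then {} else {n}) \<union> {k. k < n \<and> us k \<noteq> []}"
    by (auto simp: less_Suc_eq)
  then have "card {k. k < Suc n \<and> us k \<noteq> []} \<le> (if us n = [] then 0 else 1) + card {k. k < n \<and> us k \<noteq> []}"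
    by (auto intro: order_trans[OF card_Un_le] order_trans[OF card_insert_le_m1])
  also have "\<dots> \<le> length (concat (map us [0..<Suc n]))"
    using Suc.IH by (cases "us n") auto
  finally show ?case .
qed

lemma lpath_chain:
  assumes "\<And>k. i \<le> k \<Longrightarrow> k < j \<Longrightarrow> lpath E (c k) (us k) (c (Suc k))" "i \<le> j"
  shows "lpath E (c i) (concat (map us [i..<j])) (c j)"
  using assms(2,1)
proof (induction j rule: dec_induct)
  case base
  show ?case by (simp add: lpath.nil)
next
  case (step j)
  have "lpath E (c i) (concat (map us [i..<j])) (c j)" "lpath E (c j) (us j) (c (Suc j))"
    using step by auto
  from lpath_append[OF this] show ?case using step.hyps by simp
qed

lemma pump:
  fixes D :: "('q, 'a, 'g) transitions"
  assumes fin: "finite Q" "finite G" and q0: "q0 \<in> Q"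
    and D: "D \<subseteq> (Q \<times> UNIV) \<times> Q \<times> UNIV" "\<And>q a x p y. ((q, a, x), (p, Push y)) \<in> D \<Longrightarrow> y \<in> G"
  obtains C where "C > 0"
    "\<And>u1 q w u2 p h. lpath (wstep D) (q0, []) u1 (q, w) \<Longrightarrow>
       lpath (rstep D (tape w)) (q, int (length w)) u2 (p, h) \<Longrightarrow>
       length w > C * (length u1 + length u2 + 1) \<Longrightarrow>
       \<exists>w' h'. length w < length w' \<and> length w' \<le> length w + C \<and>
         lpath (wstep D) (q0, []) u1 (q, w') \<and>
         lpath (rstep D (tape w')) (q, int (length w')) u2 (p, h')"
proof -
  \<comment> \<open>A type consists of the state on arrival at a height, the symbol then on top,
    which the next write step inspects, and the behaviour of the part of the block pushed so far. A
    block of \<open>K\<close> cells has one cell more than there are types.\<close>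
  define T where "T = Q \<times> G \<times> Pow (Q \<times> (UNIV :: bool set) \<times> Q \<times> (UNIV :: bool set))"
  define K where "K = Suc (card T)"
  have finT: "finite T" using fin by (simp add: T_def)
  have inv: "fst c \<in> Q \<and> set (snd c) \<subseteq> G" if "lpath (wstep D) (q0, []) u c" for u c
    by (rule lpath_invariant[OF that]) (use q0 D in \<open>auto elim!: wstep.cases\<close>)
  have invQ: "fst c' \<in> Q" if "lpath (wstep D) c u c'" "fst c \<in> Q" for u c c'
    by (rule lpath_invariant[OF that(1)]) (use that(2) D in \<open>auto elim!: wstep.cases\<close>)
  have main: "\<exists>w' h'. length w < length w' \<and> length w' \<le> length w + 3 * K \<and>
         lpath (wstep D) (q0, []) u1 (q, w') \<and>
         lpath (rstep D (tape w')) (q, int (length w')) u2 (p, h')"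
    if wp: "lpath (wstep D) (q0, []) u1 (q, w)"
      and rp: "lpath (rstep D (tape w)) (q, int (length w)) u2 (p, h)"
      and long: "length w > 3 * K * (length u1 + length u2 + 1)" for u1 q w u2 p h
  proof -
    let ?n = "length w"
    obtain qs us where qs: "qs 0 = q0" "u1 = concat (map us [0..<Suc ?n])"
      "\<And>k. k < ?n \<Longrightarrow> lpath (wstep D) (qs k, take k w) (us k) (qs (Suc k), take (Suc k) w)"
      "lpath (wstep D) (qs ?n, w) (us ?n) (q, w)"
      using lpath_wstep_heights[of D q0 "[]" u1 q w] wp by auto
    obtain N where N: "finite N" "card N \<le> length u2"
      "lpath (\<lambda>c a c'. rstep D (tape w) c a c' \<and> (a = None \<or> c \<in> N)) (q, int ?n) u2 (p, h)"
      using lpath_mark[OF rp] by blast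
    define W where "W = {k. k < Suc ?n \<and> us k \<noteq> []}"
    \<comment> \<open>Letters of \<open>us k\<close> are read at height \<open>k\<close> or by the
      push that creates cell \<open>k + 1\<close>, hence \<open>Suc\<close>. Marking
      \<open>?n\<close> and \<open>nat h\<close> keeps the ends of the reading run outside the
      exchanged factor, as \<open>replace_factor\<close> demands.\<close>
    define Mk where "Mk = Suc ` W \<union> (nat \<circ> snd) ` N \<union> {?n, nat h}"
    have finMk: "finite Mk" using N by (simp add: Mk_def W_def)
    have "card Mk \<le> card W + card N + 2"
    proof -
      have "card {?n, nat h} \<le> 2" by (simp add: card_insert_if)
      moreover have "card (Suc ` W) \<le> card W" "card ((nat \<circ> snd) ` N) \<le> card N"
        using N(1) by (auto simp: W_def intro!: card_image_le)
      moreover have "card Mk \<le> card (Suc ` W) + card ((nat \<circ> snd) ` N) + card {?n, nat h}"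
        unfolding Mk_def by (meson add_right_mono card_Un_le order_trans)
      ultimately show ?thesis by linarith
    qed
    moreover have "card W \<le> length u1"
      unfolding W_def qs(2) by (rule card_nonempty_le_length_concat)
    ultimately have "card Mk < length u1 + length u2 + 3" using N(2) by linarith
    from unmarked_block[OF finMk this, of K]
    obtain b where b: "b < length u1 + length u2 + 3" "Mk \<inter> {Suc (b * K)..b * K + K} = {}"
      by (auto simp: K_def)
    define s where "s = b * K"
    \<comment> \<open>The factor 3 of the threshold: the block index is below
      \<open>length u1 + length u2 + 3\<close>, which is at most three times
      \<open>length u1 + length u2 + 1\<close>.\<close>
    have "s + K \<le> ?n"
    proof -
      have "s + K = Suc b * K" by (simp add: s_def)
      also have "\<dots> \<le> (3 * (length u1 + length u2 + 1)) * K"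
        using b(1) by (intro mult_right_mono) auto
      finally have "s + K \<le> 3 * K * (length u1 + length u2 + 1)" by (simp only: mult_ac)
      with long show ?thesis by linarith
    qed
    \<comment> \<open>The top cell is marked, so the unmarked block ends strictly below it.\<close>
    moreover have "?n \<in> Mk" by (simp add: Mk_def)
    ultimately have sK: "s + K < ?n" using b(2) by (auto simp: s_def K_def)
    have us_nil: "us k = []" if "s \<le> k" "k < s + K" for k
    proof (rule ccontr)
      assume "us k \<noteq> []"
      then have "Suc k \<in> Mk" using that sK by (auto simp: Mk_def W_def)
      with b(2) that show False by (auto simp: s_def)
    qed
    define ty where "ty i = (qs (s + i), w ! (s + i - 1), behaviour D (map Sym (take i (drop s w))))" for i
    have qsQ: "qs k \<in> Q" if "k \<le> ?n" for k
      using that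
    proof (induction k)
      case 0
      show ?case using qs(1) q0 by simp
    next
      case (Suc k)
      then show ?case using invQ[OF qs(3)[of k]] by simp
    qed
    have "ty i \<in> T" if "i \<in> {1..K}" for i
    proof -
      have "w ! (s + i - 1) \<in> G" using inv[OF wp] that sK by (auto intro: set_mp[OF _ nth_mem])
      moreover have "behaviour D (map Sym (take i (drop s w))) \<subseteq> Q \<times> UNIV \<times> Q \<times> UNIV"
        using that sK by (intro behaviour_subset[OF D(1)]) auto
      ultimately show ?thesis using qsQ that sK by (simp add: T_def ty_def)
    qed
    then have "card (ty ` {1..K}) < card {1..K}"
      using card_mono[OF finT, of "ty ` {1..K}"] by (force simp: K_def)
    then have "\<not> inj_on ty {1..K}" by (rule pigeonhole)
    then obtain i j where ij: "1 \<le> i" "i < j" "j \<le> K" "ty i = ty j"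
      by (auto simp: inj_on_def) (metis linorder_neqE_nat)
    define a0 x0 y0 z0 where "a0 = take s w" and "x0 = take i (drop s w)"
      and "y0 = take (j - i) (drop (s + i) w)" and "z0 = drop (s + j) w"
    have takes: "take (s + i) w = a0 @ x0" "take (s + j) w = a0 @ x0 @ y0"
      using ij take_add[of "s + i" "j - i" w] by (auto simp: a0_def x0_def y0_def take_add[of s i w])
    then have w: "w = a0 @ x0 @ y0 @ z0"
      by (metis append.assoc append_take_drop_id z0_def)
    have len: "length a0 = s" "length x0 = i" "length y0 = j - i"
      using ij sK by (auto simp: a0_def x0_def y0_def)
    have x0y0: "take j (drop s w) = x0 @ y0"
      unfolding w using ij by (simp add: len)
    define w' where "w' = a0 @ x0 @ y0 @ y0 @ z0"
    \<comment> \<open>No letter is read between the heights \<open>s + i\<close> and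
      \<open>s + j\<close>, so reaching \<open>s + j\<close> costs the same input as reaching
      \<open>s + i\<close>. The next fact replays the run from height \<open>s + i\<close> on top of
      the longer stack, which pushes \<open>y0\<close> a second time.\<close>
    have up: "lpath (wstep D) (q0, []) (concat (map us [0..<s + i])) (qs (s + j), a0 @ x0 @ y0)"
    proof -
      have "lpath (wstep D) (q0, []) (concat (map us [0..<s + j])) (qs (s + j), take (s + j) w)"
        using lpath_chain[of 0 "s + j" "wstep D" "\<lambda>k. (qs k, take k w)" us] qs(1,3) ij sK by auto
      moreover have "concat (map us [s + i..<s + j]) = []"
        using us_nil ij by auto
      then have "concat (map us [0..<s + j]) = concat (map us [0..<s + i])"
        using upt_add_eq_append[of 0 "s + i" "j - i"] ij by simp
      ultimately show ?thesis by (simp add: takes)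
    qed
    have down: "lpath (wstep D) (qs (s + j), a0 @ x0 @ y0) (concat (map us [s + i..<Suc ?n])) (q, w')"
    proof -
      have "lpath (wstep D) (qs (s + i), take (s + i) w) (concat (map us [s + i..<?n])) (qs ?n, take ?n w)"
        using lpath_chain[of "s + i" ?n "wstep D" "\<lambda>k. (qs k, take k w)" us] qs(3) ij sK by auto
      with qs(4) have "lpath (wstep D) (qs (s + i), take (s + i) w)
          (concat (map us [s + i..<?n]) @ us ?n) (q, w)"
        by (auto intro: lpath_append)
      moreover have "concat (map us [s + i..<?n]) @ us ?n = concat (map us [s + i..<Suc ?n])"
        using ij sK by simp
      moreover have "qs (s + i) = qs (s + j)" using ij by (simp add: ty_def)
      ultimately have "lpath (wstep D) (qs (s + j), a0 @ x0)
          (concat (map us [s + i..<Suc ?n])) (q, (a0 @ x0) @ y0 @ z0)"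
        by (simp add: takes w[symmetric])
      moreover have "top_sym (a0 @ x0) = top_sym (a0 @ x0 @ y0)"
      proof -
        have "top_sym (take k w) = Sym (w ! (k - 1))" if "0 < k" "k \<le> ?n" for k
          using that by (auto simp: top_sym_def last_map last_conv_nth)
        from this[of "s + i"] this[of "s + j"] show ?thesis
          using ij sK unfolding takes ty_def by auto
      qed
      ultimately have "lpath (wstep D) (qs (s + j), a0 @ x0 @ y0)
          (concat (map us [s + i..<Suc ?n])) (q, (a0 @ x0 @ y0) @ y0 @ z0)"
        by (rule lpath_wstep_rebase)
      then show ?thesis by (simp add: w'_def)
    qed
    have "u1 = concat (map us [0..<s + i]) @ concat (map us [s + i..<Suc ?n])"
      unfolding qs(2) using upt_add_eq_append[of 0 "s + i" "Suc ?n - (s + i)"] ij sK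
      by (simp del: upt_Suc)
    with lpath_append[OF up down] have wp': "lpath (wstep D) (q0, []) u1 (q, w')" by simp
    let ?\<alpha> = "Bottom # map Sym a0" and ?x = "map Sym x0" and ?x' = "map Sym (x0 @ y0)"
      and ?\<beta> = "map Sym (y0 @ z0) @ [Top]"
    \<comment> \<open>Both tapes share the right context formed by \<open>y0\<close>,
      \<open>z0\<close> and the top marker; it is preceded by \<open>x0\<close> on one tape and by
      \<open>x0\<close> and \<open>y0\<close> on the other.\<close>
    have t: "tape w = ?\<alpha> @ ?x @ ?\<beta>" "tape w' = ?\<alpha> @ ?x' @ ?\<beta>"
      by (simp_all add: tape_def w w'_def)
    let ?I = "{int (length ?\<alpha>)..<int (length ?\<alpha>) + int (length ?x)}"
    have outI: "k \<notin> ?I" if "nat k \<in> Mk" for k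
    proof
      assume "k \<in> ?I"
      then have "1 + int s \<le> k" "k < 1 + int s + int i" by (auto simp: len)
      then have "Suc s \<le> nat k" "nat k \<le> s + K" using ij by linarith+
      then have "nat k \<in> {Suc (b * K)..b * K + K}" by (simp add: s_def)
      with b(2) that show False by blast
    qed
    have markI: "snd c \<notin> ?I" if "c \<in> N" for c
      using that by (intro outI) (auto simp: Mk_def image_iff)
    have path: "lpath (\<lambda>c a c'. rstep D (?\<alpha> @ ?x @ ?\<beta>) c a c' \<and> (a = None \<or> snd c \<notin> ?I)) (q, int ?n) u2 (p, h)"
      unfolding t(1)[symmetric] using N(3) by (rule lpath_mono) (use markI in blast)
    have beh: "behaviour D ?x = behaviour D ?x'"
      using ij(4) unfolding ty_def x0y0 x0_def[symmetric] by simp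
    have ne: "?x \<noteq> []" "?x' \<noteq> []" "?\<alpha> \<noteq> []" "?\<beta> \<noteq> []" using len ij by auto
    have ends: "snd (q, int ?n) \<notin> ?I" "snd (p, h) \<notin> ?I"
      unfolding snd_conv by (rule outI; simp add: Mk_def)+
    note replace_factor[OF beh ne path ends]
    moreover have "(\<lambda>i. if i < int (length ?\<alpha>) then i else i + int (length ?x') - int (length ?x)) (snd (q, int ?n))
       = int (length w')"
      using sK by (simp add: w w'_def len)
    ultimately have "\<exists>h'. lpath (rstep D (tape w')) (q, int (length w')) u2 (p, h')"
      unfolding t(2) by auto
    moreover have "length w < length w'" "length w' \<le> length w + 3 * K"
      using len ij by (auto simp: w w'_def)
    ultimately show ?thesis using wp' by blast
  qed
  show thesis
    by (rule that[of "3 * K"]) (use main in \<open>auto simp: K_def\<close>)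
qed

section \<open>Short inputs for a fixed stack word\<close>

text \<open>All stack contents on the way are prefixes of \<open>w\<close>. Among these an edge is
  determined by two states, a height and the number of pushed symbols, which is 0 or 1; this gives
  the factor 2.\<close>

lemma shorten_wstep:
  assumes fin: "finite Q" and q0: "q0 \<in> Q" and D: "D \<subseteq> (Q \<times> UNIV) \<times> Q \<times> UNIV"
    and path: "lpath (wstep D) (q0, []) u (q, w)"
  obtains u' where "length u' \<le> 2 * card Q * card Q * Suc (length w)"
    "lpath (wstep D) (q0, []) u' (q, w)"
proof -
  let ?E = "\<lambda>c a c'. wstep D c a c' \<and> prefix (snd c') w"
  let ?f = "\<lambda>(p, p', k, d). ((p, take k w), (p', take (k + d) w))"
  let ?S = "Q \<times> Q \<times> {..length w} \<times> {0, 1 :: nat}"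
  have "lpath ?E c u c'" if "lpath (wstep D) c u c'" "prefix (snd c') w" for c u c'
    using that
  proof induction
    case (nil c)
    show ?case by (rule lpath.nil)
  next
    case (cons c a c1 u c2)
    have "prefix (snd c1) w"
      using lpath_wstep_prefix[OF cons.hyps(2)] cons.prems by (rule prefix_order.trans)
    with cons show ?case by (auto intro!: lpath.cons)
  qed
  from this[OF path] have path': "lpath ?E (q0, []) u (q, w)" by simp
  have fin': "finite (?f ` ?S)" using fin by auto
  have edge: "(c, c') \<in> ?f ` ?S" if "?E c a c'" for c a c'
  proof -
    have Q: "fst c \<in> Q" "fst c' \<in> Q" using that D by (auto elim!: wstep.cases)
    have "\<exists>r. snd c' = snd c @ r \<and> length r \<in> {0, 1}" using that by (auto elim!: wstep.cases)
    then obtain r where r: "snd c' = snd c @ r" "length r \<in> {0, 1}" by blast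
    with that obtain z where w: "w = snd c @ r @ z" by (auto simp: prefix_def)
    have "(fst c, fst c', length (snd c), length r) \<in> ?S" using Q r w by simp
    moreover have "(c, c') = ?f (fst c, fst c', length (snd c), length r)"
      by (simp add: prod_eq_iff r w)
    ultimately show ?thesis by (rule rev_image_eqI)
  qed
  obtain u' where u': "length u' \<le> card (?f ` ?S)" "lpath ?E (q0, []) u' (q, w)"
    by (rule lpath_shorten[OF path' fin'], erule edge)
  have "card (?f ` ?S) \<le> card ?S" using fin by (intro card_image_le) auto
  moreover have "card ?S = 2 * card Q * card Q * Suc (length w)"
    using card_cartesian_product[of Q] by (simp add: card_cartesian_product algebra_simps)
  ultimately have "length u' \<le> 2 * card Q * card Q * Suc (length w)"
    using u'(1) by linarith
  moreover have "lpath (wstep D) (q0, []) u' (q, w)"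
    using u'(2) by (rule lpath_mono) auto
  ultimately show thesis by (rule that)
qed

text \<open>On a fixed tape an edge is determined by two states, a cell and one of three head
  moves.\<close>

lemma shorten_rstep:
  assumes fin: "finite Q" and D: "D \<subseteq> (Q \<times> UNIV) \<times> Q \<times> UNIV"
    and path: "lpath (rstep D t) c u c'"
  obtains u' where "length u' \<le> 3 * card Q * card Q * length t" "lpath (rstep D t) c u' c'"
proof -
  let ?f = "\<lambda>(p, p', k, d). ((p, k), (p', k + d))"
  let ?S = "Q \<times> Q \<times> {0..<int (length t)} \<times> {-1, 0, 1 :: int}"
  have fin': "finite (?f ` ?S)" using fin by auto
  have edge: "(c, c') \<in> ?f ` ?S" if "rstep D t c a c'" for c a c'
  proof -
    have "(fst c, fst c', snd c, snd c' - snd c) \<in> ?S" "(c, c') = ?f (fst c, fst c', snd c, snd c' - snd c)"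
      using that D by (auto simp: rstep_def moves_def prod_eq_iff)
    then show ?thesis by (rule rev_image_eqI)
  qed
  obtain u' where u': "length u' \<le> card (?f ` ?S)" "lpath (rstep D t) c u' c'"
    by (rule lpath_shorten[OF path fin'], erule edge)
  have "card (?f ` ?S) \<le> card ?S" using fin by (intro card_image_le) auto
  moreover have "card ?S = 3 * card Q * card Q * length t"
    using card_cartesian_product[of Q] by (simp add: card_cartesian_product algebra_simps)
  ultimately have "length u' \<le> 3 * card Q * card Q * length t"
    using u'(1) by linarith
  then show thesis using u'(2) by (rule that)
qed

section \<open>Erasure of input labels\<close>

text \<open>Stack words and states of runs survive erasure, while the words consumed become empty.
  In \<open>pump\<close> the threshold \<open>C * (length u1 + length u2 + 1)\<close> then is just
  \<open>C\<close>.\<close>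

definition erase_labels :: "('q, 'a, 'g) transitions \<Rightarrow> ('q, 'a, 'g) transitions" where
  "erase_labels D = {((q, None, x), (p, i)) | q x p i. \<exists>a. ((q, a, x), (p, i)) \<in> D}"

lemma wstep_erase:
  "wstep (erase_labels D) c a c' \<longleftrightarrow> a = None \<and> (\<exists>b. wstep D c b c')"
proof
  assume "wstep (erase_labels D) c a c'"
  then show "a = None \<and> (\<exists>b. wstep D c b c')"
    by cases (auto simp: erase_labels_def intro: wstep.intros)
next
  assume "a = None \<and> (\<exists>b. wstep D c b c')"
  then obtain b where "a = None" "wstep D c b c'" by blast
  from this(2) show "wstep (erase_labels D) c a c'"
  proof cases
    case (stay q w p)
    then have "((q, None, top_sym w), (p, Stay)) \<in> erase_labels D"
      unfolding erase_labels_def by blast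
    with stay \<open>a = None\<close> show ?thesis by (simp only: wstep.stay)
  next
    case (push q w p y)
    then have "((q, None, top_sym w), (p, Push y)) \<in> erase_labels D"
      unfolding erase_labels_def by blast
    with push \<open>a = None\<close> show ?thesis by (simp only: wstep.push)
  qed
qed

lemma rstep_erase:
  "rstep (erase_labels D) t c a c' \<longleftrightarrow> a = None \<and> (\<exists>b. rstep D t c b c')"
  by (auto simp: rstep_def erase_labels_def)

lemma lpath_wstep_erase:
  "lpath (wstep (erase_labels D)) c [] c' \<longleftrightarrow> (\<exists>u. lpath (wstep D) c u c')"
proof -
  have "wstep (erase_labels D) = (\<lambda>c a c'. a = None \<and> (\<exists>b. wstep D c b c'))"
    by (intro ext) (rule wstep_erase)
  then show ?thesis by (simp only: lpath_erase)
qed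

lemma lpath_rstep_erase:
  "lpath (rstep (erase_labels D) t) c [] c' \<longleftrightarrow> (\<exists>u. lpath (rstep D t) c u c')"
proof -
  have "rstep (erase_labels D) t = (\<lambda>c a c'. a = None \<and> (\<exists>b. rstep D t c b c'))"
    by (intro ext) (rule rstep_erase)
  then show ?thesis by (simp only: lpath_erase)
qed


section \<open>Computations as paths\<close>

text \<open>The step relation with the remaining input removed from the configuration and the letter
  read turned into an edge label, so that runs of the machine are labelled paths.\<close>

inductive mstep ::
    "('q, 'a, 'g) sa \<Rightarrow> 'q \<times> 'g stack_symbol list \<times> 'g stack_symbol list \<Rightarrow> 'a option \<Rightarrow>
     'q \<times> 'g stack_symbol list \<times> 'g stack_symbol list \<Rightarrow> bool"
  for M where
  stay: "((q, a, x), (p, Stay)) \<in> delta M \<Longrightarrow> \<gamma> @ [x, Top] \<in> stack_words M \<Longrightarrow>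
    mstep M (q, \<gamma> @ [x], [Top]) a (p, \<gamma> @ [x], [Top])"
| push: "((q, a, x), (p, Push y)) \<in> delta M \<Longrightarrow> \<gamma> @ [x, Top] \<in> stack_words M \<Longrightarrow>
    mstep M (q, \<gamma> @ [x], [Top]) a (p, \<gamma> @ [x, Sym y], [Top])"
| pop: "((q, a, x), (p, Pop)) \<in> delta M \<Longrightarrow> \<gamma> @ [x, Top] \<in> stack_words M \<Longrightarrow> x \<noteq> Bottom \<Longrightarrow>
    mstep M (q, \<gamma> @ [x], [Top]) a (p, \<gamma>, [Top])"
| down: "((q, a, x), (p, Down)) \<in> delta M \<Longrightarrow> \<gamma>1 @ [x] @ \<gamma>2 \<in> stack_words M \<Longrightarrow> x \<noteq> Bottom \<Longrightarrow>
    mstep M (q, \<gamma>1 @ [x], \<gamma>2) a (p, \<gamma>1, [x] @ \<gamma>2)"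
| hold: "((q, a, x), (p, Hold)) \<in> delta M \<Longrightarrow> \<gamma>1 @ [x] @ \<gamma>2 \<in> stack_words M \<Longrightarrow>
    mstep M (q, \<gamma>1 @ [x], \<gamma>2) a (p, \<gamma>1 @ [x], \<gamma>2)"
| up: "((q, a, x), (p, Up)) \<in> delta M \<Longrightarrow> \<gamma>1 @ [x] @ [y] @ \<gamma>2 \<in> stack_words M \<Longrightarrow>
    mstep M (q, \<gamma>1 @ [x], [y] @ \<gamma>2) a (p, \<gamma>1 @ [x, y], \<gamma>2)"

lemma step_iff_mstep:
  "step M (q, w, g) (p, w', g') \<longleftrightarrow>
    (\<exists>a. w = consumed a @ w' \<and> w' \<in> lists (input_alph M) \<and> mstep M (q, g) a (p, g'))"
  (is "?L \<longleftrightarrow> ?R")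
proof
  assume ?L
  then consider "write_step M (q, w, g) (p, w', g')" | "read_step M (q, w, g) (p, w', g')"
    unfolding step_def by blast
  then show ?R
  proof cases
    case 1
    then show ?thesis
    proof cases
      case (stay a x \<gamma>)
      have "mstep M (q, g) a (p, g')"
        unfolding stay(2,3) using stay(4,6) by (rule mstep.stay)
      with stay(1,5) show ?thesis by blast
    next
      case (push a x y \<gamma>)
      have "mstep M (q, g) a (p, g')"
        unfolding push(2,3) using push(4,6) by (rule mstep.push)
      with push(1,5) show ?thesis by blast
    next
      case (pop a x \<gamma>)
      have "mstep M (q, g) a (p, g')"
        unfolding pop(2,3) using pop(4,6,7) by (rule mstep.pop)
      with pop(1,5) show ?thesis by blast
    qed
  next
    case 2
    then show ?thesis
    proof cases
      case (down a x \<gamma>1 \<gamma>2)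
      have "mstep M (q, g) a (p, g')"
        unfolding down(2,3) using down(4,6,7) by (rule mstep.down)
      with down(1,5) show ?thesis by blast
    next
      case (hold a x \<gamma>1 \<gamma>2)
      have "mstep M (q, g) a (p, g')"
        unfolding hold(2,3) using hold(4,6) by (rule mstep.hold)
      with hold(1,5) show ?thesis by blast
    next
      case (up a x \<gamma>1 y \<gamma>2)
      have "mstep M (q, g) a (p, g')"
        unfolding up(2,3) using up(4,6) by (rule mstep.up)
      with up(1,5) show ?thesis by blast
    qed
  qed
next
  assume ?R
  then obtain a where w: "w = consumed a @ w'" "w' \<in> lists (input_alph M)"
    and "mstep M (q, g) a (p, g')" by blast
  from this(3) show ?L
  proof cases
    case (stay x \<gamma>)
    have "write_step M (q, consumed a @ w', g) (p, w', g')"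
      unfolding stay(1,2) using stay(3) w(2) stay(4) by (rule write_step.stay)
    then show ?thesis by (simp add: step_def w(1))
  next
    case (push x y \<gamma>)
    have "write_step M (q, consumed a @ w', g) (p, w', g')"
      unfolding push(1,2) using push(3) w(2) push(4) by (rule write_step.push)
    then show ?thesis by (simp add: step_def w(1))
  next
    case (pop x \<gamma>)
    have "write_step M (q, consumed a @ w', g) (p, w', g')"
      unfolding pop(1,2) using pop(3) w(2) pop(4,5) by (rule write_step.pop)
    then show ?thesis by (simp add: step_def w(1))
  next
    case (down x \<gamma>1 \<gamma>2)
    have "read_step M (q, consumed a @ w', g) (p, w', g')"
      unfolding down(1,2) using down(3) w(2) down(4,5) by (rule read_step.down)
    then show ?thesis by (simp add: step_def w(1))
  next
    case (hold x \<gamma>1 \<gamma>2)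
    have "read_step M (q, consumed a @ w', g) (p, w', g')"
      unfolding hold(1,2) using hold(3) w(2) hold(4) by (rule read_step.hold)
    then show ?thesis by (simp add: step_def w(1))
  next
    case (up x \<gamma>1 y \<gamma>2)
    have "read_step M (q, consumed a @ w', g) (p, w', g')"
      unfolding up(1,2) using up(3) w(2) up(4) by (rule read_step.up)
    then show ?thesis by (simp add: step_def w(1))
  qed
qed

lemma delta_typed:
  assumes "stack_automaton M" "((q, a, x), (p, i)) \<in> delta M"
  shows "q \<in> states M" "p \<in> states M" "set (consumed a) \<subseteq> input_alph M" "i \<in> instrs M"
proof -
  have "((q, a, x), (p, i)) \<in> (states M \<times> insert None (Some ` input_alph M) \<times> stack_alph M)
                 \<times> (states M \<times> instrs M)"
    using assms unfolding stack_automaton_def by blast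
  then show "q \<in> states M" "p \<in> states M" "set (consumed a) \<subseteq> input_alph M" "i \<in> instrs M"
    by auto
qed

lemma push_typed:
  assumes "stack_automaton M" "((q, a, x), (p, Push y)) \<in> delta M"
  shows "y \<in> work_alph M"
  using delta_typed(4)[OF assms] by (auto simp: instrs_def)

lemma delta_states:
  "stack_automaton M \<Longrightarrow> delta M \<subseteq> (states M \<times> UNIV) \<times> states M \<times> UNIV"
  unfolding stack_automaton_def by blast

lemma steps_iff_lpath:
  assumes "w \<in> lists (input_alph M)"
  shows "(step M)\<^sup>*\<^sup>* (q, w, g) (p, w', g') \<longleftrightarrow>
    (\<exists>u. w = u @ w' \<and> lpath (mstep M) (q, g) u (p, g'))"
proof
  have "\<exists>u. w = u @ fst (snd c) \<and> lpath (mstep M) (q, g) u (fst c, snd (snd c))"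
    if "(step M)\<^sup>*\<^sup>* (q, w, g) c" for c
    using that
  proof induction
    case base
    show ?case by (auto intro: lpath.nil)
  next
    case (step c c1)
    then obtain u where u: "w = u @ fst (snd c)" "lpath (mstep M) (q, g) u (fst c, snd (snd c))"
      by blast
    have "step M (fst c, fst (snd c), snd (snd c)) (fst c1, fst (snd c1), snd (snd c1))"
      using step.hyps(2) by simp
    then obtain a where a: "fst (snd c) = consumed a @ fst (snd c1)"
      "mstep M (fst c, snd (snd c)) a (fst c1, snd (snd c1))"
      unfolding step_iff_mstep by blast
    show ?case
      using u(1) a(1) lpath_snoc[OF u(2) a(2)] by (intro exI[of _ "u @ consumed a"]) simp
  qed
  from this[of "(p, w', g')"]
  show "\<exists>u. w = u @ w' \<and> lpath (mstep M) (q, g) u (p, g')" if "(step M)\<^sup>*\<^sup>* (q, w, g) (p, w', g')"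
    using that by simp
next
  have "(step M)\<^sup>*\<^sup>* (fst c, u @ w', snd c) (fst c', w', snd c')"
    if "lpath (mstep M) c u c'" "u @ w' \<in> lists (input_alph M)" for c u c'
    using that
  proof induction
    case (nil c)
    then show ?case by simp
  next
    case (cons c a c1 u c2)
    then have "step M (fst c, (consumed a @ u) @ w', snd c) (fst c1, u @ w', snd c1)"
      unfolding step_iff_mstep by auto
    moreover have "(step M)\<^sup>*\<^sup>* (fst c1, u @ w', snd c1) (fst c2, w', snd c2)"
      using cons by auto
    ultimately show ?case by (rule converse_rtranclp_into_rtranclp)
  qed
  note * = this
  show "(step M)\<^sup>*\<^sup>* (q, w, g) (p, w', g')" if "\<exists>u. w = u @ w' \<and> lpath (mstep M) (q, g) u (p, g')"
  proof -
    from that obtain u where "w = u @ w'" "lpath (mstep M) (q, g) u (p, g')" by blast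
    with *[of "(q, g)" u "(p, g')"] assms show ?thesis by simp
  qed
qed

section \<open>Tape positions and the split of a run into two phases\<close>

text \<open>The scanned symbol is the last one of the left list, so cell \<open>k\<close>, counted
  from 0, is scanned when that list has \<open>k + 1\<close> symbols.\<close>

definition head_at :: "'g stack_symbol list \<Rightarrow> nat \<Rightarrow> 'g stack_symbol list \<times> 'g stack_symbol list" where
  "head_at t k = (take (Suc k) t, drop (Suc k) t)"

lemma head_at_top: "head_at (tape w) (length w) = (Bottom # map Sym w, [Top])"
  by (simp add: head_at_def tape_def)

lemma tape_in_stack_words: "tape w \<in> stack_words M \<longleftrightarrow> w \<in> lists (work_alph M)"
proof -
  have "inj (map Sym :: 'a list \<Rightarrow> 'a stack_symbol list)" by (auto intro: injI)
  then show ?thesis by (auto simp: stack_words_def tape_def inj_eq)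
qed

lemma wstep_imp_mstep:
  assumes "wstep (delta M) (q, w) a (p, w')" "w \<in> lists (work_alph M)"
  shows "mstep M (q, head_at (tape w) (length w)) a (p, head_at (tape w') (length w'))"
proof -
  let ?\<gamma> = "butlast (Bottom # map Sym w)"
  have split: "Bottom # map Sym w = ?\<gamma> @ [top_sym w]"
    unfolding top_sym_def by (rule append_butlast_last_id[symmetric]) simp
  have "(?\<gamma> @ [top_sym w]) @ [Top] \<in> stack_words M"
    using assms(2) tape_in_stack_words[of w M] unfolding split[symmetric] tape_def by simp
  then have sw: "?\<gamma> @ [top_sym w, Top] \<in> stack_words M"
    unfolding append_assoc append_Cons append_Nil .
  from assms(1) show ?thesis
  proof cases
    case stay
    then show ?thesis
      unfolding head_at_top using mstep.stay[OF _ sw] split by simp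
  next
    case (push y)
    have "Bottom # map Sym w' = ?\<gamma> @ [top_sym w, Sym y]"
      using split push(1) by (metis append.assoc append_Cons append_Nil list.simps(8,9) map_append)
    then show ?thesis
      unfolding head_at_top using mstep.push[OF push(2) sw] split by simp
  qed
qed

lemma take_Suc_tape: "k < length w + 2 \<Longrightarrow> take (Suc k) (tape w) = take k (tape w) @ [tape w ! k]"
  by (simp add: take_Suc_conv_app_nth)

lemma nth_tape_eq_Bottom: "k < length w + 2 \<Longrightarrow> tape w ! k = Bottom \<longleftrightarrow> k = 0"
  by (cases k) (auto simp: tape_def nth_append)

lemma rstep_imp_mstep:
  assumes "rstep (delta M) (tape w) (q, h) a (p, h')" "w \<in> lists (work_alph M)"
  shows "mstep M (q, head_at (tape w) (nat h)) a (p, head_at (tape w) (nat h'))"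
proof -
  let ?t = "tape w"
  from assms(1) obtain i where d: "((q, a, ?t ! nat h), (p, i)) \<in> delta M" and i: "(i, h' - h) \<in> moves"
    and r: "0 \<le> h" "h < int (length ?t)" "0 \<le> h'" "h' < int (length ?t)"
    by (auto simp: rstep_def)
  have k: "nat h < length w + 2" "nat h' < length w + 2" using r by auto
  have drop: "drop (nat h) ?t = ?t ! nat h # drop (Suc (nat h)) ?t"
    using k by (simp add: Cons_nth_drop_Suc)
  have sw: "take (nat h) ?t @ [?t ! nat h] @ drop (Suc (nat h)) ?t \<in> stack_words M"
    using assms(2) drop by (simp add: tape_in_stack_words flip: drop)
  consider "i = Down" "h = h' + 1" | "i = Hold" "h' = h" | "i = Up" "h' = h + 1"
    using i by (auto simp: moves_def)
  then show ?thesis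
  proof cases
    case 1
    then have "nat h = Suc (nat h')" using r by auto
    \<comment> \<open>\<open>rstep\<close> forbids moving down from the bottom marker by requiring a
      nonnegative target position; this is turned back into the condition on the scanned
      symbol.\<close>
    then have "?t ! nat h \<noteq> Bottom" using nth_tape_eq_Bottom[OF k(1)] by simp
    with 1 d sw have "mstep M (q, take (nat h) ?t @ [?t ! nat h], drop (Suc (nat h)) ?t) a
       (p, take (nat h) ?t, [?t ! nat h] @ drop (Suc (nat h)) ?t)"
      by (intro mstep.down) auto
    then show ?thesis
      unfolding head_at_def take_Suc_tape[OF k(1)] using drop \<open>nat h = Suc (nat h')\<close> by simp
  next
    case 2
    with d sw have "mstep M (q, take (nat h) ?t @ [?t ! nat h], drop (Suc (nat h)) ?t) a
       (p, take (nat h) ?t @ [?t ! nat h], drop (Suc (nat h)) ?t)"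
      by (intro mstep.hold) auto
    then show ?thesis by (simp add: head_at_def take_Suc_tape[OF k(1)] 2(2))
  next
    case 3
    then have h': "nat h' = Suc (nat h)" using r by auto
    then have drop': "drop (Suc (nat h)) ?t = ?t ! nat h' # drop (Suc (nat h')) ?t"
      using k(2) by (simp add: Cons_nth_drop_Suc)
    with 3 d sw have "mstep M (q, take (nat h) ?t @ [?t ! nat h], [?t ! nat h'] @ drop (Suc (nat h')) ?t) a
       (p, take (nat h) ?t @ [?t ! nat h, ?t ! nat h'], drop (Suc (nat h')) ?t)"
      by (intro mstep.up) auto
    moreover have "take (Suc (nat h')) ?t = take (nat h) ?t @ [?t ! nat h, ?t ! nat h']"
      using take_Suc_tape[OF k(1)] take_Suc_tape[OF k(2)] h' by simp
    ultimately show ?thesis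
      unfolding head_at_def take_Suc_tape[OF k(1)] using drop' by simp
  qed
qed

lemma phases_imp_lpath_mstep:
  assumes M: "stack_automaton M"
    and wp: "lpath (wstep (delta M)) (init M, []) u1 (q, w)"
    and rp: "lpath (rstep (delta M) (tape w)) (q, int (length w)) u2 (p, h)"
  shows "lpath (mstep M) (init M, [Bottom], [Top]) (u1 @ u2) (p, head_at (tape w) (nat h))"
proof -
  have wp': "snd c \<in> lists (work_alph M) \<and>
      lpath (mstep M) (init M, [Bottom], [Top]) u (fst c, head_at (tape (snd c)) (length (snd c)))"
    if "lpath (wstep (delta M)) (init M, []) u c" for u c
    using that
  proof (induction rule: lpath_snoc_induct)
    case nil
    show ?case by (simp add: lpath.nil head_at_def tape_def)
  next
    case (snoc u c1 a c2)
    have "mstep M (fst c1, head_at (tape (snd c1)) (length (snd c1))) a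
        (fst c2, head_at (tape (snd c2)) (length (snd c2)))"
      using snoc by (intro wstep_imp_mstep) auto
    moreover have "snd c2 \<in> lists (work_alph M)"
      using snoc.hyps(2) snoc.IH push_typed[OF M] by cases auto
    ultimately show ?case using snoc.IH by (blast intro: lpath_snoc)
  qed
  have "lpath (mstep M) (fst c, head_at (tape w) (nat (snd c))) u (fst c', head_at (tape w) (nat (snd c')))"
    if "lpath (rstep (delta M) (tape w)) c u c'" for c u c'
    using that
  proof induction
    case (nil c)
    show ?case by (rule lpath.nil)
  next
    case (cons c a c1 u c2)
    have "mstep M (fst c, head_at (tape w) (nat (snd c))) a (fst c1, head_at (tape w) (nat (snd c1)))"
      using cons.hyps(1) wp'[OF wp] by (intro rstep_imp_mstep) auto
    then show ?case using cons.IH by (rule lpath.cons)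
  qed
  from this[OF rp] wp'[OF wp] show ?thesis by (auto intro: lpath_append)
qed

text \<open>Write states only write, read states only move the head, and a read state is never left
  for a write state. So all write steps precede all head moves, and the tape is fixed during the
  second phase.\<close>

lemma lpath_mstep_imp_phases:
  assumes M: "checking_stack_automaton M"
    and path: "lpath (mstep M) (init M, [Bottom], [Top]) u (p, g)"
  obtains u1 u2 q w h where "u = u1 @ u2" "lpath (wstep (delta M)) (init M, []) u1 (q, w)"
    "lpath (rstep (delta M) (tape w)) (q, int (length w)) u2 (p, int h)"
    "h < length w + 2" "g = head_at (tape w) h"
proof -
  from M have sa: "stack_automaton M" and ne: "non_erasing M"
    by (auto simp: checking_stack_automaton_def)
  from M obtain Qw Qr where part: "partitioned_into M Qw Qr"
    and rw: "\<And>q a y p i. ((q, a, y), (p, i)) \<in> delta M \<Longrightarrow> q \<in> Qr \<Longrightarrow> p \<notin> Qw"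
    unfolding checking_stack_automaton_def by blast
  let ?D = "delta M"
  have cases: "q \<in> Qw \<and> i \<in> insert Stay (range Push) \<or> q \<in> Qr \<and> q \<notin> Qw \<and> p \<notin> Qw \<and> i \<in> {Down, Hold, Up}"
    if "((q, a, x), (p, i)) \<in> ?D" for q a x p i
  proof -
    have "q \<in> Qw \<union> Qr" "Qw \<inter> Qr = {}" using part delta_typed(1)[OF sa that] by (auto simp: partitioned_into_def)
    moreover have "i \<noteq> Pop" using ne that by (auto simp: non_erasing_def)
    ultimately show ?thesis using part that rw[OF that] unfolding partitioned_into_def by blast
  qed
  \<comment> \<open>The last conjunct carries the induction: in a write state the second phase is
    still empty and the head is on top, so a further write step extends the first phase.\<close>
  have "\<exists>u1 u2 q w h. u = u1 @ u2 \<and> lpath (wstep ?D) (init M, []) u1 (q, w) \<and>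
      lpath (rstep ?D (tape w)) (q, int (length w)) u2 (fst c, int h) \<and> h < length w + 2 \<and>
      snd c = head_at (tape w) h \<and> (fst c \<in> Qw \<longrightarrow> u2 = [] \<and> q = fst c \<and> h = length w)"
    if "lpath (mstep M) (init M, [Bottom], [Top]) u c" for u c
    using that
  proof (induction rule: lpath_snoc_induct)
    case nil
    show ?case
      by (intro exI[of _ "[]"] exI[of _ "init M"] exI[of _ "0 :: nat"])
        (auto simp: head_at_def tape_def intro: lpath.nil)
  next
    case (snoc u c a c')
    then obtain u1 u2 q w h where
      u: "u = u1 @ u2" and wp: "lpath (wstep ?D) (init M, []) u1 (q, w)"
      and rp: "lpath (rstep ?D (tape w)) (q, int (length w)) u2 (fst c, int h)"
      and h: "h < length w + 2" and g: "snd c = head_at (tape w) h"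
      and wr: "fst c \<in> Qw \<Longrightarrow> u2 = [] \<and> q = fst c \<and> h = length w"
      by blast
    let ?t = "tape w"
    have writing: ?case
      if "wstep ?D (fst c, w) a (fst c', w')" "snd c' = head_at (tape w') (length w')" "fst c \<in> Qw" for w'
    proof -
      have "lpath (wstep ?D) (init M, []) (u @ consumed a) (fst c', w')"
        using wp wr[OF that(3)] u that(1) by (auto intro: lpath_snoc)
      then show ?thesis
        using that(2)
        by (intro exI[of _ "u @ consumed a"] exI[of _ "[]"] exI[of _ "fst c'"] exI[of _ w'] exI[of _ "length w'"])
          (auto intro: lpath.nil)
    qed
    have reading: ?case
      if "((fst c, a, ?t ! h), (fst c', i)) \<in> ?D" "(i, int h' - int h) \<in> moves"
        "h' < length w + 2" "snd c' = head_at ?t h'" for i h'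
    proof -
      have "rstep ?D ?t (fst c, int h) a (fst c', int h')"
        using that h by (auto simp: rstep_def)
      with rp have "lpath (rstep ?D ?t) (q, int (length w)) (u2 @ consumed a) (fst c', int h')"
        by (rule lpath_snoc)
      moreover have "fst c' \<notin> Qw"
        using cases[OF that(1)] that(2) by (auto simp: moves_def)
      ultimately show ?thesis
        using u wp that(3,4) by (intro exI[of _ u1] exI[of _ "u2 @ consumed a"] exI[of _ q] exI[of _ w] exI[of _ h']) auto
    qed
    have head: "x = ?t ! h" "\<gamma> = take h ?t" if "take (Suc h) ?t = \<gamma> @ [x]" for \<gamma> x
      using that take_Suc_tape[OF h] by auto
    have top: "x = top_sym w" "\<gamma> @ [x] = Bottom # map Sym w"
      if "take (Suc h) ?t = \<gamma> @ [x]" "fst c \<in> Qw" for \<gamma> x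
    proof -
      have "take (Suc h) ?t = Bottom # map Sym w"
        using wr[OF that(2)] by (simp add: tape_def)
      with that(1) show "x = top_sym w" "\<gamma> @ [x] = Bottom # map Sym w"
        by (auto simp: top_sym_def)
    qed
    from snoc.hyps(2) show ?case
    proof cases
      case (stay q' x p' \<gamma>)
      with cases[OF stay(3)] have qw: "fst c \<in> Qw" by auto
      have tk: "take (Suc h) ?t = \<gamma> @ [x]" using g stay(1) by (simp add: head_at_def)
      show ?thesis
        using stay qw top[OF tk qw] by (intro writing[of w]) (auto simp: head_at_top intro: wstep.stay)
    next
      case (push q' x p' y \<gamma>)
      with cases[OF push(3)] have qw: "fst c \<in> Qw" by auto
      have tk: "take (Suc h) ?t = \<gamma> @ [x]" using g push(1) by (simp add: head_at_def)
      have "\<gamma> @ [x, Sym y] = Bottom # map Sym (w @ [y])"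
        using top(2)[OF tk qw] by (metis append.assoc append_Cons append_Nil list.simps(8,9) map_append)
      then have "snd c' = head_at (tape (w @ [y])) (length (w @ [y]))"
        using push(2) by (simp only: head_at_top snd_conv)
      then show ?thesis
        using push qw top[OF tk qw] by (intro writing[of "w @ [y]"]) (simp_all add: wstep.push)
    next
      case (pop q' x p' \<gamma>)
      then show ?thesis using ne by (auto simp: non_erasing_def)
    next
      case (down q' x p' \<gamma>1 \<gamma>2)
      have tk: "take (Suc h) ?t = \<gamma>1 @ [x]" "drop (Suc h) ?t = \<gamma>2" using g down(1) by (simp_all add: head_at_def)
      have "h \<noteq> 0" using head(1)[OF tk(1)] down(5) nth_tape_eq_Bottom[OF h] by auto
      then obtain h' where h': "h = Suc h'" by (cases h) auto
      have "[x] @ \<gamma>2 = drop (Suc h') ?t"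
        using h head(1)[OF tk(1)] tk(2) Cons_nth_drop_Suc[of h ?t] h' by simp
      then show ?thesis
        using down head[OF tk(1)] h h'
        by (intro reading[of Down h']) (auto simp: moves_def head_at_def)
    next
      case (hold q' x p' \<gamma>1 \<gamma>2)
      have tk: "take (Suc h) ?t = \<gamma>1 @ [x]" using g hold(1) by (simp add: head_at_def)
      show ?thesis
        using hold head[OF tk] h g by (intro reading[of Hold h]) (auto simp: moves_def)
    next
      case (up q' x p' \<gamma>1 y \<gamma>2)
      have tk: "take (Suc h) ?t = \<gamma>1 @ [x]" "drop (Suc h) ?t = y # \<gamma>2" using g up(1) by (simp_all add: head_at_def)
      have h': "Suc h < length w + 2"
      proof (rule ccontr)
        assume "\<not> ?thesis"
        then have "drop (Suc h) ?t = []" by simp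
        with tk(2) show False by simp
      qed
      have "y = ?t ! Suc h" "\<gamma>2 = drop (Suc (Suc h)) ?t"
        using tk(2) h' Cons_nth_drop_Suc[of "Suc h" ?t] by auto
      then have "head_at ?t (Suc h) = (\<gamma>1 @ [x, y], \<gamma>2)"
        using take_Suc_tape[OF h'] tk(1) by (simp add: head_at_def)
      then show ?thesis
        using up head[OF tk(1)] h' by (intro reading[of Up "Suc h"]) (auto simp: moves_def)
    qed
  qed
  from this[OF path] show thesis
    unfolding fst_conv snd_conv using that by blast
qed

section \<open>Stack sizes of computations\<close>

text \<open>Only end configurations are collected. Without \<open>Pop\<close> the size never
  decreases along a run, so these are exactly the sizes of the computations over which the measure
  \<open>z\<close> takes its supremum.\<close>

definition sizes :: "measure_kind \<Rightarrow> ('q, 'a, 'g) sa \<Rightarrow> 'a list \<Rightarrow> nat set" where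
  "sizes z M u = {config_size c | c. (step M)\<^sup>*\<^sup>* (init M, u, [Bottom], [Top]) c \<and>
     (z = Accept \<longrightarrow> fst (snd c) = [] \<and> fst c \<in> final M)}"

lemma sizesI:
  "(step M)\<^sup>*\<^sup>* (init M, u, [Bottom], [Top]) c \<Longrightarrow>
    (z = Accept \<Longrightarrow> fst (snd c) = [] \<and> fst c \<in> final M) \<Longrightarrow> config_size c \<in> sizes z M u"
  unfolding sizes_def by blast

lemma config_size_head_at: "config_size (p, v, head_at (tape w) k) = length w"
  by (simp add: head_at_def)

lemma mstep_config_size:
  assumes "non_erasing M" "mstep M c a c'"
  shows "config_size (fst c, v, snd c) \<le> config_size (fst c', v', snd c')"
  using assms(2,1) by cases (auto simp: non_erasing_def)

lemma step_config_size:
  assumes "non_erasing M" "step M c c'"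
  shows "config_size c \<le> config_size c'"
proof -
  obtain q w g p w' g' where c: "c = (q, w, g)" "c' = (p, w', g')" by (cases c; cases c') auto
  with assms(2) obtain a where "mstep M (q, g) a (p, g')" unfolding c step_iff_mstep by blast
  from mstep_config_size[OF assms(1) this] show ?thesis unfolding c by simp
qed

lemma successively_step:
  assumes "non_erasing M" "successively (step M) cs" "cs \<noteq> []"
  shows "(step M)\<^sup>*\<^sup>* (hd cs) (last cs) \<and> (\<forall>c\<in>set cs. config_size c \<le> config_size (last cs))"
  using assms(3,2)
proof (induction cs rule: list_nonempty_induct)
  case (cons c cs)
  then have "step M c (hd cs)" and IH: "(step M)\<^sup>*\<^sup>* (hd cs) (last cs)"
    "\<forall>c\<in>set cs. config_size c \<le> config_size (last cs)"
    by (auto simp: successively_Cons)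
  moreover have "config_size c \<le> config_size (last cs)"
    using step_config_size[OF assms(1) \<open>step M c (hd cs)\<close>] IH(2) cons.hyps hd_in_set
    by (meson order_trans)
  ultimately show ?case using cons.hyps by (auto intro: converse_rtranclp_into_rtranclp)
qed simp

lemma rtranclp_imp_successively:
  assumes "R\<^sup>*\<^sup>* x y"
  obtains xs where "xs \<noteq> []" "hd xs = x" "last xs = y" "successively R xs"
proof -
  have "\<exists>xs. xs \<noteq> [] \<and> hd xs = x \<and> last xs = y \<and> successively R xs"
    using assms
  proof (induction rule: converse_rtranclp_induct)
    case base
    show ?case by (intro exI[of _ "[y]"]) simp
  next
    case (step x z)
    then obtain xs where "xs \<noteq> []" "hd xs = z" "last xs = y" "successively R xs" by blast
    with step.hyps(1) show ?case
      by (intro exI[of _ "x # xs"]) (auto simp: successively_Cons)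
  qed
  then show thesis using that by blast
qed

lemma computation_size_last:
  assumes "non_erasing M" "successively (step M) cs" "cs \<noteq> []"
  shows "computation_size cs = config_size (last cs)"
  unfolding computation_size_def
  using successively_step[OF assms] assms(3) by (intro Max_eqI) auto

lemma word_space_eq:
  assumes "non_erasing M" "u \<in> lists (input_alph M)"
  shows "word_space z M u = (SUP n\<in>sizes z M u. enat n)"
proof -
  define P where "P cs \<longleftrightarrow> partial_computation M u cs \<and>
      (z = Accept \<longrightarrow> fst (snd (last cs)) = [] \<and> fst (last cs) \<in> final M)" for cs
  have "sizes z M u = computation_size ` {cs. P cs}"
  proof (intro equalityI subsetI)
    fix n assume "n \<in> sizes z M u"
    then obtain c where c: "n = config_size c" "(step M)\<^sup>*\<^sup>* (init M, u, [Bottom], [Top]) c"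
      "z = Accept \<longrightarrow> fst (snd c) = [] \<and> fst c \<in> final M"
      by (auto simp: sizes_def)
    obtain cs where cs: "cs \<noteq> []" "hd cs = (init M, u, [Bottom], [Top])" "last cs = c" "successively (step M) cs"
      using rtranclp_imp_successively[OF c(2)] by blast
    then have "P cs" "computation_size cs = n"
      using c assms computation_size_last[OF assms(1) cs(4,1)] by (auto simp: P_def partial_computation_def)
    then show "n \<in> computation_size ` {cs. P cs}" by blast
  next
    fix n assume "n \<in> computation_size ` {cs. P cs}"
    then obtain cs where cs: "P cs" "n = computation_size cs" by blast
    then have pc: "cs \<noteq> []" "successively (step M) cs" "hd cs = (init M, u, [Bottom], [Top])"
      by (auto simp: P_def partial_computation_def)
    show "n \<in> sizes z M u"
      unfolding cs(2) computation_size_last[OF assms(1) pc(2,1)]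
      using successively_step[OF assms(1) pc(2,1)] cs(1) pc(3) by (intro sizesI) (auto simp: P_def)
  qed
  moreover have "word_space z M u = (SUP cs\<in>{cs. P cs}. enat (computation_size cs))"
  proof (cases z)
    case Accept
    have "accepting_computation M u = P"
      by (intro ext) (auto simp: P_def Accept accepting_computation_def computation_def)
    then show ?thesis by (simp add: Accept)
  qed (simp add: P_def)
  ultimately show ?thesis by (simp add: image_image)
qed

lemma accepted_language_eq:
  assumes "non_erasing M"
  shows "accepted_language M = {u \<in> lists (input_alph M). sizes Accept M u \<noteq> {}}"
proof -
  have "(\<exists>cs. accepting_computation M u cs) \<longleftrightarrow> sizes Accept M u \<noteq> {}" if "u \<in> lists (input_alph M)" for u
  proof
    assume "\<exists>cs. accepting_computation M u cs"
    then obtain cs where "accepting_computation M u cs" by blast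
    then have "config_size (last cs) \<in> sizes Accept M u"
      using successively_step[OF assms, of cs]
      by (intro sizesI) (auto simp: accepting_computation_def computation_def partial_computation_def)
    then show "sizes Accept M u \<noteq> {}" by blast
  next
    assume "sizes Accept M u \<noteq> {}"
    then obtain c where c: "(step M)\<^sup>*\<^sup>* (init M, u, [Bottom], [Top]) c" "fst (snd c) = []" "fst c \<in> final M"
      by (auto simp: sizes_def)
    obtain cs where "cs \<noteq> []" "hd cs = (init M, u, [Bottom], [Top])" "last cs = c" "successively (step M) cs"
      using rtranclp_imp_successively[OF c(1)] by blast
    with c that show "\<exists>cs. accepting_computation M u cs"
      by (auto simp: accepting_computation_def computation_def partial_computation_def)
  qed
  then show ?thesis by (auto simp: accepted_language_def)
qed

text \<open>The interface between the machine and the combinatorics of paths. \<open>v\<close> is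
  the input left unread: arbitrary for the strong measure, empty for the accept measure.\<close>

lemma sizes_phases:
  assumes M: "checking_stack_automaton M" and u: "u \<in> lists (input_alph M)"
  shows "n \<in> sizes z M u \<longleftrightarrow> (\<exists>w u1 u2 v q p h. n = length w \<and> u = u1 @ u2 @ v \<and>
    lpath (wstep (delta M)) (init M, []) u1 (q, w) \<and>
    lpath (rstep (delta M) (tape w)) (q, int (length w)) u2 (p, h) \<and>
    (z = Accept \<longrightarrow> v = [] \<and> p \<in> final M))" (is "_ \<longleftrightarrow> ?R")
proof
  assume "n \<in> sizes z M u"
  then obtain p v g where c: "n = config_size (p, v, g)"
    "(step M)\<^sup>*\<^sup>* (init M, u, [Bottom], [Top]) (p, v, g)" "z = Accept \<longrightarrow> v = [] \<and> p \<in> final M"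
    by (force simp: sizes_def)
  then obtain u' where u': "u = u' @ v" "lpath (mstep M) (init M, [Bottom], [Top]) u' (p, g)"
    unfolding steps_iff_lpath[OF u] by blast
  obtain u1 u2 q w h where ph: "u' = u1 @ u2" "lpath (wstep (delta M)) (init M, []) u1 (q, w)"
    "lpath (rstep (delta M) (tape w)) (q, int (length w)) u2 (p, int h)"
    "h < length w + 2" "g = head_at (tape w) h"
    using lpath_mstep_imp_phases[OF M u'(2)] by metis
  moreover have "n = length w" using c(1) ph(4,5) by (simp add: head_at_def)
  ultimately show ?R using u'(1) c(3) by (metis append.assoc)
next
  assume ?R
  then obtain w u1 u2 v q p h where *: "n = length w" "u = u1 @ u2 @ v"
    "lpath (wstep (delta M)) (init M, []) u1 (q, w)"
    "lpath (rstep (delta M) (tape w)) (q, int (length w)) u2 (p, h)"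
    "z = Accept \<longrightarrow> v = [] \<and> p \<in> final M" by blast
  have "stack_automaton M" using M by (simp add: checking_stack_automaton_def)
  from phases_imp_lpath_mstep[OF this *(3,4)]
  have "(step M)\<^sup>*\<^sup>* (init M, u, [Bottom], [Top]) (p, v, head_at (tape w) (nat h))"
    unfolding steps_iff_lpath[OF u] using *(2) by auto
  moreover have "config_size (p, v, head_at (tape w) (nat h)) = n"
    by (simp only: config_size_head_at *(1))
  ultimately show "n \<in> sizes z M u"
    using *(5) sizesI[of M u "(p, v, head_at (tape w) (nat h))" z] by simp
qed

text \<open>Pumping keeps the words read, the unread rest and the last state, so the longer run
  counts for the same measure on the same input.\<close>

lemma sizes_pump:
  assumes M: "checking_stack_automaton M"
  obtains C where "C > 0" "\<And>u n. u \<in> lists (input_alph M) \<Longrightarrow> n \<in> sizes z M u \<Longrightarrow>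
    n > C * (length u + 1) \<Longrightarrow> \<exists>n'\<in>sizes z M u. n < n' \<and> n' \<le> n + C"
proof -
  have sa: "stack_automaton M" using M by (simp add: checking_stack_automaton_def)
  then have fin: "finite (states M)" "finite (work_alph M)" "init M \<in> states M"
    by (auto simp: stack_automaton_def)
  obtain C where C: "C > 0"
    "\<And>u1 q w u2 p h. lpath (wstep (delta M)) (init M, []) u1 (q, w) \<Longrightarrow>
       lpath (rstep (delta M) (tape w)) (q, int (length w)) u2 (p, h) \<Longrightarrow>
       length w > C * (length u1 + length u2 + 1) \<Longrightarrow>
       \<exists>w' h'. length w < length w' \<and> length w' \<le> length w + C \<and>
         lpath (wstep (delta M)) (init M, []) u1 (q, w') \<and>
         lpath (rstep (delta M) (tape w')) (q, int (length w')) u2 (p, h')"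
    by (rule pump[OF fin delta_states[OF sa]], erule push_typed[OF sa], erule that, blast)
  have "\<exists>n'\<in>sizes z M u. n < n' \<and> n' \<le> n + C"
    if u: "u \<in> lists (input_alph M)" and n: "n \<in> sizes z M u" "n > C * (length u + 1)" for u n
  proof -
    obtain w u1 u2 v q p h where *: "n = length w" "u = u1 @ u2 @ v"
      "lpath (wstep (delta M)) (init M, []) u1 (q, w)"
      "lpath (rstep (delta M) (tape w)) (q, int (length w)) u2 (p, h)"
      "z = Accept \<longrightarrow> v = [] \<and> p \<in> final M"
      using n(1) unfolding sizes_phases[OF M u] by blast
    have "C * (length u1 + length u2 + 1) \<le> C * (length u + 1)" using *(2) by simp
    with n(2) have "length w > C * (length u1 + length u2 + 1)" unfolding *(1) by linarith
    from C(2)[OF *(3,4) this] obtain w' h' where "length w < length w'" "length w' \<le> length w + C"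
       "lpath (wstep (delta M)) (init M, []) u1 (q, w')"
       "lpath (rstep (delta M) (tape w')) (q, int (length w')) u2 (p, h')" by blast
    moreover from this have "length w' \<in> sizes z M u"
      unfolding sizes_phases[OF M u] using *(2,5) by blast
    ultimately show ?thesis unfolding *(1) by blast
  qed
  with C(1) show thesis by (rule that)
qed

lemma sizes_short_input:
  assumes M: "checking_stack_automaton M"
  obtains C where "C > 0" "\<And>u n. u \<in> lists (input_alph M) \<Longrightarrow> n \<in> sizes z M u \<Longrightarrow>
    \<exists>u'\<in>lists (input_alph M). length u' \<le> C * (n + 1) \<and> n \<in> sizes z M u'"
proof -
  have sa: "stack_automaton M" using M by (simp add: checking_stack_automaton_def)
  then have fin: "finite (states M)" "init M \<in> states M"
    by (auto simp: stack_automaton_def)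
  let ?k = "card (states M) * card (states M)"
  \<comment> \<open>The two phases contribute \<open>2 * ?k * (n + 1)\<close> and
    \<open>3 * ?k * (n + 2)\<close>, and \<open>n + 2\<close> is at most \<open>2 * (n + 1)\<close>;
    this gives 8. The summand 1 makes the constant positive. Unread input is dropped.\<close>
  have "\<exists>u'\<in>lists (input_alph M). length u' \<le> (8 * ?k + 1) * (n + 1) \<and> n \<in> sizes z M u'"
    if u: "u \<in> lists (input_alph M)" and n: "n \<in> sizes z M u" for u n
  proof -
    obtain w u1 u2 v q p h where *: "n = length w" "u = u1 @ u2 @ v"
      "lpath (wstep (delta M)) (init M, []) u1 (q, w)"
      "lpath (rstep (delta M) (tape w)) (q, int (length w)) u2 (p, h)"
      "z = Accept \<longrightarrow> v = [] \<and> p \<in> final M"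
      using n(1) unfolding sizes_phases[OF M u] by blast
    obtain u1' where u1': "length u1' \<le> 2 * card (states M) * card (states M) * Suc (length w)"
      "lpath (wstep (delta M)) (init M, []) u1' (q, w)"
      using shorten_wstep[OF fin delta_states[OF sa] *(3)] by blast
    obtain u2' where u2': "length u2' \<le> 3 * card (states M) * card (states M) * length (tape w)"
      "lpath (rstep (delta M) (tape w)) (q, int (length w)) u2' (p, h)"
      using shorten_rstep[OF fin(1) delta_states[OF sa] *(4)] by blast
    have "u1' \<in> lists (input_alph M)"
      by (rule lpath_lists[OF u1'(2)]) (auto elim!: wstep.cases dest: delta_typed(3)[OF sa])
    moreover have "u2' \<in> lists (input_alph M)"
      by (rule lpath_lists[OF u2'(2)]) (auto simp: rstep_def dest: delta_typed(3)[OF sa])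
    ultimately have lists: "u1' @ u2' \<in> lists (input_alph M)" by simp
    have "length (u1' @ u2') \<le> 2 * ?k * (n + 1) + 3 * ?k * (n + 2)"
      using u1'(1) u2'(1) *(1) by (simp add: algebra_simps)
    also have "\<dots> \<le> 2 * ?k * (n + 1) + 3 * ?k * (2 * (n + 1))"
      by (intro add_left_mono mult_left_mono) auto
    also have "\<dots> \<le> (8 * ?k + 1) * (n + 1)" by (simp add: algebra_simps)
    finally have "length (u1' @ u2') \<le> (8 * ?k + 1) * (n + 1)" .
    moreover have "n \<in> sizes z M (u1' @ u2')"
      unfolding sizes_phases[OF M lists] using *(1,5) u1'(2) u2'(2)
      by (intro exI[of _ w] exI[of _ u1'] exI[of _ u2'] exI[of _ "[]"]) auto
    ultimately show ?thesis using lists by blast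
  qed
  then show thesis by (intro that[of "8 * ?k + 1"]) auto
qed

text \<open>Pumping with all labels erased: the input may change, but no bound on it is needed.\<close>

lemma sizes_gap:
  assumes M: "checking_stack_automaton M"
  obtains C where "C > 0" "\<And>u n. u \<in> lists (input_alph M) \<Longrightarrow> n \<in> sizes z M u \<Longrightarrow> n > C \<Longrightarrow>
    \<exists>u'\<in>lists (input_alph M). \<exists>n'\<in>sizes z M u'. n < n' \<and> n' \<le> n + C"
proof -
  have sa: "stack_automaton M" using M by (simp add: checking_stack_automaton_def)
  then have fin: "finite (states M)" "finite (work_alph M)" "init M \<in> states M"
    by (auto simp: stack_automaton_def)
  let ?D = "erase_labels (delta M)"
  have D: "?D \<subseteq> (states M \<times> UNIV) \<times> states M \<times> UNIV"
    using delta_states[OF sa] by (auto simp: erase_labels_def)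
  have G: "y \<in> work_alph M" if "((q, a, x), (p, Push y)) \<in> ?D" for q a x p y
    using that push_typed[OF sa] by (auto simp: erase_labels_def)
  obtain C where C: "C > 0"
    "\<And>u1 q w u2 p h. lpath (wstep ?D) (init M, []) u1 (q, w) \<Longrightarrow>
       lpath (rstep ?D (tape w)) (q, int (length w)) u2 (p, h) \<Longrightarrow>
       length w > C * (length u1 + length u2 + 1) \<Longrightarrow>
       \<exists>w' h'. length w < length w' \<and> length w' \<le> length w + C \<and>
         lpath (wstep ?D) (init M, []) u1 (q, w') \<and>
         lpath (rstep ?D (tape w')) (q, int (length w')) u2 (p, h')"
    by (rule pump[OF fin D], erule G, erule that, blast)
  have "\<exists>u'\<in>lists (input_alph M). \<exists>n'\<in>sizes z M u'. n < n' \<and> n' \<le> n + C"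
    if u: "u \<in> lists (input_alph M)" and n: "n \<in> sizes z M u" "n > C" for u n
  proof -
    obtain w u1 u2 v q p h where *: "n = length w" "u = u1 @ u2 @ v"
      "lpath (wstep (delta M)) (init M, []) u1 (q, w)"
      "lpath (rstep (delta M) (tape w)) (q, int (length w)) u2 (p, h)"
      "z = Accept \<longrightarrow> v = [] \<and> p \<in> final M"
      using n(1) unfolding sizes_phases[OF M u] by blast
    have "lpath (wstep ?D) (init M, []) [] (q, w)"
      "lpath (rstep ?D (tape w)) (q, int (length w)) [] (p, h)"
      using *(3,4) unfolding lpath_wstep_erase lpath_rstep_erase by blast+
    from C(2)[OF this] n(2) *(1) obtain w' h' where w': "length w < length w'" "length w' \<le> length w + C"
       "lpath (wstep ?D) (init M, []) [] (q, w')"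
       "lpath (rstep ?D (tape w')) (q, int (length w')) [] (p, h')" by auto
    then obtain u1' u2' where u': "lpath (wstep (delta M)) (init M, []) u1' (q, w')"
       "lpath (rstep (delta M) (tape w')) (q, int (length w')) u2' (p, h')"
      unfolding lpath_wstep_erase lpath_rstep_erase by blast
    have "u1' \<in> lists (input_alph M)"
      by (rule lpath_lists[OF u'(1)]) (auto elim!: wstep.cases dest: delta_typed(3)[OF sa])
    moreover have "u2' \<in> lists (input_alph M)"
      by (rule lpath_lists[OF u'(2)]) (auto simp: rstep_def dest: delta_typed(3)[OF sa])
    ultimately have lists: "u1' @ u2' \<in> lists (input_alph M)" by simp
    moreover have "length w' \<in> sizes z M (u1' @ u2')"
      unfolding sizes_phases[OF M lists] using *(5) u'
      by (intro exI[of _ w'] exI[of _ u1'] exI[of _ u2'] exI[of _ "[]"]) auto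
    ultimately show ?thesis using w'(1,2) unfolding *(1) by blast
  qed
  with C(1) show thesis by (rule that)
qed

section \<open>Regularity\<close>

text \<open>The residual automaton of Myhill and Nerode. Automata have natural numbers as states, so
  residuals are coded by an injection \<open>g\<close>; \<open>d\<close> decodes a state, takes the
  residual by one letter and codes it again.\<close>

lemma regular_language_if_finite_residuals:
  assumes A: "finite A" and L: "L \<subseteq> lists A"
    and fin: "finite ((\<lambda>u. {v. u @ v \<in> L}) ` lists A)"
  shows "regular_language A L"
proof -
  define R where "R u = {v. u @ v \<in> L}" for u
  define S where "S = R ` lists A"
  have "finite S" using fin by (simp add: S_def R_def)
  then obtain g :: "'a list set \<Rightarrow> nat" where g: "inj_on g S"
    using finite_imp_inj_to_nat_seg[OF \<open>finite S\<close>] by blast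
  define d where "d m a = g {v. a # v \<in> inv_into S g m}" for m a
  define F where "F = g ` {X \<in> S. [] \<in> X}"
  have RS: "R u \<in> S" if "u \<in> lists A" for u using that by (simp add: S_def)
  have d: "d (g (R u)) a = g (R (u @ [a]))" if "u \<in> lists A" for u a
    unfolding d_def inv_into_f_f[OF g RS[OF that]] by (simp add: R_def)
  have run: "foldl d (g (R [])) u = g (R u)" if "u \<in> lists A" for u
    using that
  proof (induction u rule: rev_induct)
    case (snoc a u)
    then have "foldl d (g (R [])) u = g (R u)" "d (g (R u)) a = g (R (u @ [a]))"
      using d by simp_all
    then show ?case by simp
  qed simp
  have "foldl d (g (R [])) u \<in> F \<longleftrightarrow> u \<in> L" if "u \<in> lists A" for u
  proof -
    have "g (R u) \<in> F \<longleftrightarrow> [] \<in> R u"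
      using RS[OF that] inj_onD[OF g] by (auto simp: F_def)
    then show ?thesis unfolding run[OF that] by (simp add: R_def)
  qed
  then have lang: "L = {w \<in> lists A. foldl d (g (R [])) w \<in> F}" using L by blast
  have closed: "d q a \<in> g ` S" if "q \<in> g ` S" "a \<in> A" for q a
  proof -
    from that(1) obtain u where "u \<in> lists A" "q = g (R u)" by (auto simp: S_def)
    with that(2) d[of u a] RS[of "u @ [a]"] show ?thesis by simp
  qed
  have "g (R []) \<in> g ` S" using RS[of "[]"] by simp
  moreover have "F \<subseteq> g ` S" unfolding F_def by blast
  moreover have "finite (g ` S)" using \<open>finite S\<close> by simp
  ultimately have "finite (g ` S) \<and> g (R []) \<in> g ` S \<and> F \<subseteq> g ` S \<and>
      (\<forall>q\<in>g ` S. \<forall>a\<in>A. d q a \<in> g ` S) \<and> L = {w \<in> lists A. foldl d (g (R [])) w \<in> F}"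
    using closed lang by simp
  with A show ?thesis unfolding regular_language_def by blast
qed

text \<open>Two of infinitely many words lead a finite automaton to the same state and cannot be
  told apart by any continuation.\<close>

lemma not_regular_languageI:
  fixes w :: "nat \<Rightarrow> 'a list"
  assumes w: "\<And>i. w i \<in> lists A"
    and sep: "\<And>i j. i < j \<Longrightarrow> \<exists>v\<in>lists A. (w i @ v \<in> L) \<noteq> (w j @ v \<in> L)"
  shows "\<not> regular_language A L"
proof
  assume "regular_language A L"
  then obtain Q :: "nat set" and d q0 F where Q: "finite Q" "q0 \<in> Q" "\<forall>q\<in>Q. \<forall>a\<in>A. d q a \<in> Q"
    and L: "L = {w \<in> lists A. foldl d q0 w \<in> F}"
    unfolding regular_language_def by blast
  have run: "foldl d q u \<in> Q" if "u \<in> lists A" "q \<in> Q" for u q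
    using that by (induction u arbitrary: q) (use Q in auto)
  have "finite (range (\<lambda>i. foldl d q0 (w i)))"
    using Q(1) by (rule finite_subset[rotated]) (use run w Q(2) in auto)
  then have "\<not> inj (\<lambda>i. foldl d q0 (w i))"
    using finite_imageD infinite_UNIV_nat by blast
  then obtain i j where ij: "i < j" "foldl d q0 (w i) = foldl d q0 (w j)"
    unfolding inj_on_def by (metis linorder_neqE_nat)
  then obtain v where "v \<in> lists A" "(w i @ v \<in> L) \<noteq> (w j @ v \<in> L)"
    using sep by blast
  then show False using ij(2) w by (simp add: L)
qed

text \<open>A configuration of size above \<open>B\<close> cannot lead to acceptance. The residual
  of \<open>u\<close> is therefore determined by the set of configurations in the finite set
  \<open>C\<close> that are reachable by reading \<open>u\<close>, which leaves at most as many
  residuals as \<open>C\<close> has subsets.\<close>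

lemma bounded_sizes_imp_regular:
  fixes M :: "('q, 'a, 'g) sa"
  assumes M: "checking_stack_automaton M"
    and B: "\<And>u n. u \<in> lists (input_alph M) \<Longrightarrow> n \<in> sizes Accept M u \<Longrightarrow> n \<le> B"
  shows "regular_language (input_alph M) (accepted_language M)"
proof -
  let ?A = "input_alph M" and ?L = "accepted_language M"
  let ?c0 = "(init M, [Bottom], [Top])"
  from M have sa: "stack_automaton M" and ne: "non_erasing M"
    by (auto simp: checking_stack_automaton_def)
  then have fin: "finite ?A" "finite (states M)" "finite (work_alph M)" "init M \<in> states M"
    by (auto simp: stack_automaton_def)
  have L: "u \<in> ?L \<longleftrightarrow> (\<exists>c. lpath (mstep M) ?c0 u c \<and> fst c \<in> final M)" if "u \<in> lists ?A" for u
  proof -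
    have "u \<in> ?L \<longleftrightarrow> (\<exists>p g. (step M)\<^sup>*\<^sup>* (init M, u, [Bottom], [Top]) (p, [], g) \<and> p \<in> final M)"
      unfolding accepted_language_eq[OF ne] using that by (fastforce simp: sizes_def)
    then show ?thesis by (auto simp: steps_iff_lpath[OF that])
  qed
  define C where "C = states M \<times> (\<lambda>(w, h). head_at (tape w) h) `
      ({w. set w \<subseteq> work_alph M \<and> length w \<le> B} \<times> {..<B + 2})"
  have "finite C" unfolding C_def using fin finite_lists_length_le[OF fin(3)] by auto
  define res where "res X = {v \<in> lists ?A. \<exists>c\<in>X. \<exists>c'. lpath (mstep M) c v c' \<and> fst c' \<in> final M}" for X
  have "{v. u @ v \<in> ?L} = res ({c. lpath (mstep M) ?c0 u c} \<inter> C)" if u: "u \<in> lists ?A" for u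
  proof (intro equalityI subsetI)
    fix v assume "v \<in> res ({c. lpath (mstep M) ?c0 u c} \<inter> C)"
    then show "v \<in> {v. u @ v \<in> ?L}"
      using u L[of "u @ v"] by (auto simp: res_def intro: lpath_append)
  next
    fix v assume "v \<in> {v. u @ v \<in> ?L}"
    then have uv: "u @ v \<in> ?L" by simp
    then have v: "v \<in> lists ?A" by (auto simp: accepted_language_def)
    with u have uvA: "u @ v \<in> lists ?A" by simp
    from uv obtain c' where c': "lpath (mstep M) ?c0 (u @ v) c'" "fst c' \<in> final M"
      unfolding L[OF uvA] by blast
    obtain c where c: "lpath (mstep M) ?c0 u c" "lpath (mstep M) c v c'"
      by (rule lpath_split[OF c'(1)])
    obtain p g where pg: "c = (p, g)" by (cases c)
    obtain u1 u2 q w h where ph: "lpath (wstep (delta M)) (init M, []) u1 (q, w)"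
      "lpath (rstep (delta M) (tape w)) (q, int (length w)) u2 (p, int h)"
      "h < length w + 2" "g = head_at (tape w) h"
      using lpath_mstep_imp_phases[OF M c(1)[unfolded pg]] by metis
    \<comment> \<open>Sizes do not decrease, so the bound known for accepting configurations also
      holds for the configuration reached after \<open>u\<close>.\<close>
    have mono: "config_size (fst c, [] :: 'a list, snd c) \<le> config_size (fst c', [] :: 'a list, snd c')"
      using c(2)
    proof induction
      case (cons c a c1 u c2)
      then show ?case using mstep_config_size[OF ne cons.hyps(1), of "[] :: 'a list" "[] :: 'a list"] by linarith
    qed simp
    have "(step M)\<^sup>*\<^sup>* (init M, u @ v, [Bottom], [Top]) (fst c', [], snd c')"
      unfolding steps_iff_lpath[OF uvA] using c'(1) by simp
    then have "config_size (fst c', [] :: 'a list, snd c') \<in> sizes Accept M (u @ v)"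
      using c'(2) by (intro sizesI) auto
    from B[OF uvA this] mono have "length w \<le> B"
      unfolding pg ph(4) fst_conv snd_conv config_size_head_at by linarith
    moreover have "set (snd (q, w)) \<subseteq> work_alph M"
      by (rule lpath_invariant[OF ph(1)]) (auto elim!: wstep.cases dest: push_typed[OF sa])
    moreover have "fst (q, w) \<in> states M"
      by (rule lpath_invariant[OF ph(1)]) (auto elim!: wstep.cases dest: delta_typed(2)[OF sa] simp: fin(4))
    then have "fst (p, int h) \<in> states M"
      by (intro lpath_invariant[OF ph(2), of "\<lambda>c. fst c \<in> states M"])
        (auto simp: rstep_def dest: delta_typed(2)[OF sa])
    ultimately have "c \<in> C" using ph(3,4) unfolding pg C_def by auto
    with c c'(2) v show "v \<in> res ({c. lpath (mstep M) ?c0 u c} \<inter> C)"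
      unfolding res_def by blast
  qed
  then have "(\<lambda>u. {v. u @ v \<in> ?L}) ` lists ?A \<subseteq> res ` Pow C" by auto
  then have "finite ((\<lambda>u. {v. u @ v \<in> ?L}) ` lists ?A)"
    by (rule finite_subset) (use \<open>finite C\<close> in simp)
  then show ?thesis
    by (intro regular_language_if_finite_residuals fin(1)) (auto simp: accepted_language_def)
qed


section \<open>Growth of the space measures\<close>

lemma sizes_Accept_subset: "sizes Accept M u \<subseteq> sizes z M u"
  by (auto simp: sizes_def)

lemma SUP_enat_eq_infinity_iff: "(SUP n\<in>S. enat n) = \<infinity> \<longleftrightarrow> infinite S"
proof -
  have "finite (enat ` S) \<longleftrightarrow> finite S" by (rule finite_image_iff) (simp add: inj_on_def)
  moreover have "Max (enat ` S) \<noteq> \<infinity>" if "finite S" "S \<noteq> {}"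
  proof -
    have "Max (enat ` S) \<in> enat ` S" using that by (intro Max_in) auto
    then show ?thesis by (metis enat.distinct(2) imageE)
  qed
  ultimately show ?thesis by (auto simp: Sup_enat_def)
qed

lemma limited_iff_finite_sizes:
  assumes "checking_stack_automaton M"
  shows "limited z M \<longleftrightarrow> (\<forall>u\<in>lists (input_alph M). finite (sizes z M u))"
proof -
  have "non_erasing M" using assms by (simp add: checking_stack_automaton_def)
  then show ?thesis
    using word_space_eq[of M] by (auto simp: unlimited_def SUP_enat_eq_infinity_iff)
qed

lemma unlimited_caseI:
  assumes "unlimited z M"
  shows "unlimited_case z M"
proof -
  obtain u where u: "u \<in> lists (input_alph M)" "word_space z M u = \<infinity>"
    using assms by (auto simp: unlimited_def)
  then have "\<infinity> \<le> length_space z M (length u)"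
    unfolding length_space_def by (intro SUP_upper2[of u]) auto
  then show ?thesis using assms by (auto simp: unlimited_case_def in_bigo_def)
qed

text \<open>The finitely many sizes for one input have a maximum; above the threshold
  \<open>sizes_pump\<close> would produce a larger one.\<close>

lemma limited_imp_linear_bound:
  assumes M: "checking_stack_automaton M" and lim: "limited z M"
  obtains C where "C > 0"
    "\<And>u n. u \<in> lists (input_alph M) \<Longrightarrow> n \<in> sizes z M u \<Longrightarrow> n \<le> C * (length u + 1)"
proof -
  obtain C where C: "C > 0" "\<And>u n. u \<in> lists (input_alph M) \<Longrightarrow> n \<in> sizes z M u \<Longrightarrow>
    n > C * (length u + 1) \<Longrightarrow> \<exists>n'\<in>sizes z M u. n < n' \<and> n' \<le> n + C"
    by (rule sizes_pump[OF M, where z = z], erule that, blast)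
  have "n \<le> C * (length u + 1)" if u: "u \<in> lists (input_alph M)" and n: "n \<in> sizes z M u" for u n
  proof -
    let ?m = "Max (sizes z M u)"
    have fin: "finite (sizes z M u)" using lim u limited_iff_finite_sizes[OF M] by blast
    then have "?m \<in> sizes z M u" using n by (intro Max_in) auto
    with fin have "?m \<le> C * (length u + 1)" using C(2)[OF u, of ?m] Max_ge[OF fin] by (meson not_le)
    with Max_ge[OF fin n] show ?thesis by linarith
  qed
  with C(1) show thesis by (rule that)
qed

lemma space_le:
  assumes M: "checking_stack_automaton M"
    and B: "\<And>u n. u \<in> lists (input_alph M) \<Longrightarrow> length u \<le> N \<Longrightarrow> n \<in> sizes z M u \<Longrightarrow> n \<le> b"
  shows "length_space z M N \<le> enat b" "space_upto z M N \<le> enat b"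
proof -
  have "non_erasing M" using M by (simp add: checking_stack_automaton_def)
  then have "word_space z M u \<le> enat b" if "u \<in> lists (input_alph M)" "length u \<le> N" for u
    using B[OF that] that(1) by (simp add: word_space_eq SUP_least)
  then show "length_space z M N \<le> enat b" "space_upto z M N \<le> enat b"
    unfolding length_space_def space_upto_def by (auto intro!: SUP_least)
qed

lemma le_space:
  assumes M: "checking_stack_automaton M" and "u \<in> lists (input_alph M)" "n \<in> sizes z M u"
  shows "enat n \<le> length_space z M (length u)" "length u \<le> N \<Longrightarrow> enat n \<le> space_upto z M N"
proof -
  have "non_erasing M" using M by (simp add: checking_stack_automaton_def)
  then have n: "enat n \<le> word_space z M u"
    using assms(2,3) by (auto simp: word_space_eq intro: SUP_upper)
  show "enat n \<le> length_space z M (length u)"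
    unfolding length_space_def using assms(2) n by (intro SUP_upper2[of u]) auto
  show "enat n \<le> space_upto z M N" if "length u \<le> N"
    unfolding space_upto_def using assms(2) that n by (intro SUP_upper2[of u]) auto
qed

lemma the_enat_le:
  assumes "s \<le> enat b"
  shows "s \<noteq> \<infinity>" "the_enat s \<le> b"
  using assms by (cases s; simp)+

lemma le_the_enat: "enat n \<le> s \<Longrightarrow> s \<noteq> \<infinity> \<Longrightarrow> n \<le> the_enat s"
  by (cases s) auto

lemma constant_caseI:
  assumes M: "checking_stack_automaton M" and lim: "limited z M"
    and B: "\<And>u n. u \<in> lists (input_alph M) \<Longrightarrow> n \<in> sizes z M u \<Longrightarrow> n \<le> B"
  shows "constant_case z M"
proof -
  have le: "length_space z M n \<le> enat B" for n
    using B by (intro space_le(1)[OF M]) auto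
  have "(\<lambda>n. real (the_enat (length_space z M n))) \<in> O(\<lambda>n. 1)"
    using the_enat_le(2)[OF le] by (intro bigoI[of _ "real B"] always_eventually) auto
  \<comment> \<open>Regularity concerns accepting computations, and their sizes are among the
    bounded ones for either measure.\<close>
  moreover have "regular_language (input_alph M) (accepted_language M)"
    using B sizes_Accept_subset[of M _ z] by (intro bounded_sizes_imp_regular[OF M, of B]) blast
  ultimately show ?thesis
    using lim the_enat_le(1)[OF le] by (auto simp: constant_case_def in_bigo_def)
qed

text \<open>\<open>C\<close> bounds size by input length, \<open>C2\<close> bounds the length of
  some input attaining a given size, and \<open>C3\<close> bounds the gap to a larger attained size.
  \<open>C\<close> gives the upper bounds, \<open>C\<close> and \<open>C2\<close> refute
  \<open>o(n)\<close>, and \<open>C2\<close> and \<open>C3\<close> give the lower bound for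
  \<open>space_upto\<close>.\<close>

lemma linear_caseI:
  assumes M: "checking_stack_automaton M" and lim: "limited z M"
    and unb: "\<And>B. \<exists>u\<in>lists (input_alph M). \<exists>n\<in>sizes z M u. n > B"
  shows "linear_case z M"
proof -
  let ?A = "input_alph M"
  define l where "l n = real (the_enat (length_space z M n))" for n
  define s where "s n = real (the_enat (space_upto z M n))" for n
  obtain C where C: "C > 0"
    "\<And>u n. u \<in> lists ?A \<Longrightarrow> n \<in> sizes z M u \<Longrightarrow> n \<le> C * (length u + 1)"
    by (rule limited_imp_linear_bound[OF M lim], erule that, blast)
  obtain C2 where C2: "C2 > 0" "\<And>u n. u \<in> lists ?A \<Longrightarrow> n \<in> sizes z M u \<Longrightarrow>
    \<exists>u'\<in>lists ?A. length u' \<le> C2 * (n + 1) \<and> n \<in> sizes z M u'"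
    by (rule sizes_short_input[OF M, where z = z], erule that, blast)
  obtain C3 where C3: "C3 > 0" "\<And>u n. u \<in> lists ?A \<Longrightarrow> n \<in> sizes z M u \<Longrightarrow> n > C3 \<Longrightarrow>
    \<exists>u'\<in>lists ?A. \<exists>n'\<in>sizes z M u'. n < n' \<and> n' \<le> n + C3"
    by (rule sizes_gap[OF M, where z = z], erule that, blast)
  have le: "length_space z M n \<le> enat (C * (n + 1))" "space_upto z M n \<le> enat (C * (n + 1))" for n
  proof -
    have *: "m \<le> C * (n + 1)" if "u \<in> lists ?A" "length u \<le> n" "m \<in> sizes z M u" for u m
    proof -
      have "C * (length u + 1) \<le> C * (n + 1)" using that(2) by simp
      with C(2)[OF that(1,3)] show ?thesis by (rule order_trans)
    qed
    show "length_space z M n \<le> enat (C * (n + 1))" "space_upto z M n \<le> enat (C * (n + 1))"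
      by (rule space_le[OF M], rule *, assumption+)+
  qed
  note fin = the_enat_le(1)[OF le(1)] the_enat_le(1)[OF le(2)]
  have upper: "l n \<le> 2 * real C * real n" "s n \<le> 2 * real C * real n" if "n \<ge> 1" for n
  proof -
    have "C * (n + 1) \<le> C * (2 * n)" using that by (intro mult_left_mono) auto
    then have "the_enat (length_space z M n) \<le> 2 * C * n" "the_enat (space_upto z M n) \<le> 2 * C * n"
      using the_enat_le(2)[OF le(1), of n] the_enat_le(2)[OF le(2), of n] by linarith+
    then show "l n \<le> 2 * real C * real n" "s n \<le> 2 * real C * real n"
      unfolding l_def s_def by (metis of_nat_le_iff of_nat_mult of_nat_numeral)+
  qed
  have l_O: "l \<in> O(\<lambda>n. real n)"
  proof (rule bigoI)
    show "eventually (\<lambda>n. norm (l n) \<le> (2 * real C) * norm (real n)) at_top"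
      unfolding eventually_at_top_linorder
      by (intro exI[of _ 1]) (use upper(1) in \<open>simp add: l_def\<close>)
  qed
  have s_O: "s \<in> O(\<lambda>n. real n)"
  proof (rule bigoI)
    show "eventually (\<lambda>n. norm (s n) \<le> (2 * real C) * norm (real n)) at_top"
      unfolding eventually_at_top_linorder
      by (intro exI[of _ 1]) (use upper(2) in \<open>simp add: s_def\<close>)
  qed
  have not_o: "\<not> in_smallo (length_space z M) (\<lambda>n. real n)"
  proof
    \<comment> \<open>Size \<open>m\<close> is attained on some input of length at most
      \<open>C2 * (m + 1)\<close>. With this \<open>c\<close> the little-o estimate there gives less
      than \<open>(m + 1) / 2\<close>, which is at most \<open>m\<close>.\<close>
    define c where "c = 1 / (2 * real C2)"
    have c: "c > 0" using C2(1) by (simp add: c_def)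
    assume "in_smallo (length_space z M) (\<lambda>n. real n)"
    then obtain n0 where n0: "\<And>n. n > n0 \<Longrightarrow> l n < c * real n"
      using c unfolding in_smallo_def l_def by blast
    \<comment> \<open>By the linear upper bound, every input attaining a size above
      \<open>C * (n0 + 1)\<close> is longer than \<open>n0\<close>.\<close>
    obtain u m where m: "u \<in> lists ?A" "m \<in> sizes z M u" "m > C * (n0 + 1)"
      using unb by blast
    obtain u' where u': "u' \<in> lists ?A" "length u' \<le> C2 * (m + 1)" "m \<in> sizes z M u'"
      using C2(2)[OF m(1,2)] by blast
    have "length u' > n0"
    proof (rule ccontr)
      assume "\<not> ?thesis"
      then have "C * (length u' + 1) \<le> C * (n0 + 1)" by simp
      with C(2)[OF u'(1,3)] m(3) show False by linarith
    qed
    then have "l (length u') < c * real (length u')" by (rule n0)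
    also have "\<dots> \<le> c * real (C2 * (m + 1))"
      using u'(2) c by (intro mult_left_mono of_nat_mono) auto
    also have "\<dots> = (real m + 1) / 2" using C2(1) by (simp add: c_def field_simps)
    also have "\<dots> \<le> real m" using m(3) by simp
    also have "\<dots> \<le> l (length u')"
      unfolding l_def using le_the_enat[OF le_space(1)[OF M u'(1,3)] fin(1)] by simp
    finally show False by simp
  qed
  have s_Omega: "s \<in> \<Omega>(\<lambda>n. real n)"
  proof -
    obtain u0 m0 where m0: "u0 \<in> lists ?A" "m0 \<in> sizes z M u0" "m0 > C3"
      using unb by blast
    \<comment> \<open>The first summand puts \<open>m0\<close> into the set \<open>X\<close> below;
      the second makes \<open>C2 * (C3 + 1)\<close> at most half of \<open>N\<close>.\<close>
    define N0 where "N0 = C2 * (m0 + 1) + 2 * C2 * (C3 + 1)"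
    have "real N \<le> 2 * real C2 * s N" if N: "N \<ge> N0" for N
    proof -
      \<comment> \<open>The sizes that \<open>C2\<close> guarantees on inputs of length at most
        \<open>N\<close>. A larger size within distance \<open>C3\<close> of the maximum falls
        outside \<open>X\<close>, which forces the maximum to be linear in \<open>N\<close>.\<close>
      define X where "X = {m. \<exists>u\<in>lists ?A. m \<in> sizes z M u \<and> C2 * (m + 1) \<le> N}"
      have "m \<le> N" if "m \<in> X" for m
      proof -
        have "1 * (m + 1) \<le> C2 * (m + 1)" using C2(1) by (intro mult_right_mono) auto
        with that show ?thesis by (auto simp: X_def)
      qed
      then have finX: "finite X" by (meson finite_nat_set_iff_bounded_le)
      have "m0 \<in> X" using m0 N by (auto simp: X_def N0_def)
      then have mX: "Max X \<in> X" "m0 \<le> Max X" using finX by (auto intro: Max_in)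
      then obtain u where u: "u \<in> lists ?A" "Max X \<in> sizes z M u" "C2 * (Max X + 1) \<le> N"
        by (auto simp: X_def)
      obtain u' n' where u': "u' \<in> lists ?A" "n' \<in> sizes z M u'" "Max X < n'" "n' \<le> Max X + C3"
        using C3(2)[OF u(1,2)] mX(2) m0(3) by auto
      have "n' \<notin> X" using Max_ge[OF finX] u'(3) by (meson not_le)
      then have "N < C2 * (n' + 1)" using u'(1,2) by (auto simp: X_def)
      also have "\<dots> \<le> C2 * (Max X + (C3 + 1))" using u'(4) by (intro mult_left_mono) auto
      finally have "N < C2 * Max X + C2 * (C3 + 1)" by (simp add: algebra_simps)
      moreover have "2 * (C2 * (C3 + 1)) \<le> N" using N by (simp add: N0_def)
      ultimately have "N \<le> 2 * C2 * Max X" by linarith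
      moreover have "Max X \<le> the_enat (space_upto z M N)"
      proof -
        obtain u'' where "u'' \<in> lists ?A" "length u'' \<le> C2 * (Max X + 1)" "Max X \<in> sizes z M u''"
          using C2(2)[OF u(1,2)] by blast
        with u(3) show ?thesis
          by (intro le_the_enat[OF le_space(2)[OF M] fin(2)]) auto
      qed
      then have "2 * C2 * Max X \<le> 2 * C2 * the_enat (space_upto z M N)" by simp
      ultimately have "N \<le> 2 * C2 * the_enat (space_upto z M N)" by linarith
      then show ?thesis
        unfolding s_def by (metis of_nat_le_iff of_nat_mult of_nat_numeral)
    qed
    then have "eventually (\<lambda>N. norm (real N) \<le> (2 * real C2) * norm (s N)) at_top"
      unfolding eventually_at_top_linorder by (intro exI[of _ N0]) (simp add: s_def)
    then have "(\<lambda>n. real n) \<in> O(s)" by (rule bigoI)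
    then show ?thesis by (simp add: bigomega_iff_bigo)
  qed
  have "s \<in> \<Theta>(\<lambda>n. real n)" using s_O s_Omega by (rule bigthetaI)
  then show ?thesis
    using lim l_O not_o fin
    unfolding linear_case_def in_bigo_def in_bigtheta_def l_def[abs_def] s_def[abs_def] by simp
qed

lemma trichotomy:
  assumes "checking_stack_automaton M"
  shows "unlimited_case z M \<or> constant_case z M \<or> linear_case z M"
proof (cases "unlimited z M")
  case True
  then show ?thesis by (simp add: unlimited_caseI)
next
  case lim: False
  show ?thesis
  proof (cases "\<exists>B. \<forall>u\<in>lists (input_alph M). \<forall>n\<in>sizes z M u. n \<le> B")
    case True
    then show ?thesis using constant_caseI[OF assms lim] by blast
  next
    case False
    then show ?thesis using linear_caseI[OF assms lim] by (meson not_le)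
  qed
qed

text \<open>A bounded function is below \<open>c * n\<close> as soon as \<open>c * n\<close> exceeds
  the bound, so \<open>O(1)\<close> is contained in \<open>o(n)\<close>.\<close>

lemma not_constant_and_linear: "\<not> (constant_case z M \<and> linear_case z M)"
proof
  let ?l = "\<lambda>n. real (the_enat (length_space z M n))"
  assume "constant_case z M \<and> linear_case z M"
  then have fin: "\<forall>n. length_space z M n \<noteq> \<infinity>" and O1: "?l \<in> O(\<lambda>n. 1)"
    and not_o: "\<not> in_smallo (length_space z M) (\<lambda>n. real n)"
    by (auto simp: constant_case_def linear_case_def in_bigo_def)
  from O1 obtain b where "eventually (\<lambda>n. norm (?l n) \<le> b * norm (1 :: real)) at_top"
    by (elim landau_o.bigE)
  then obtain n1 where n1: "\<And>n. n \<ge> n1 \<Longrightarrow> ?l n \<le> b"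
    unfolding eventually_at_top_linorder by auto
  have "\<exists>n0. \<forall>n>n0. ?l n < c * real n" if "c > 0" for c
  proof -
    from reals_Archimedean3[OF that] obtain n2 where n2: "b < real n2 * c" by blast
    have "?l n < c * real n" if "n > max n1 n2" for n
    proof -
      have "real n2 * c \<le> real n * c" using that \<open>c > 0\<close> by (intro mult_right_mono) auto
      then show ?thesis using n1[of n] n2 that by (simp add: mult.commute)
    qed
    then show ?thesis by blast
  qed
  with fin not_o show False by (auto simp: in_smallo_def)
qed

section \<open>Witnesses\<close>

text \<open>The flag \<open>l\<close> allows padding symbols that make the automaton unlimited without changing its
  language; the flag \<open>c\<close> compares the number of ones in the input with the stack and makes the
  language \<open>{0\<^sup>n 1\<^sup>n}\<close> instead of \<open>{0\<^sup>n}\<close>.\<close>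

definition witness :: "bool \<Rightarrow> bool \<Rightarrow> (nat, nat, nat) sa" where
  "witness l c = \<lparr>states = {0, 1, 2}, input_alph = {0, 1}, work_alph = {0, 1},
     delta = {((q, a, x), (p, i)). x \<in> {Bottom, Sym 0, Sym 1} \<and>
       (q = 0 \<and> a = Some 0 \<and> p = 0 \<and> i = Push 0 \<or>
        q = 0 \<and> a = None \<and> p = 0 \<and> i = Push 1 \<and> l \<or>
        q = 0 \<and> a = None \<and> p = 1 \<and> i = Stay \<or>
        q = 1 \<and> a = Some 1 \<and> p = 1 \<and> i = Down \<and> x = Sym 0 \<and> c \<or>
        q = 1 \<and> a = None \<and> p = 1 \<and> i = Down \<and> x = Sym 1 \<and> c \<or>
        q = 1 \<and> a = None \<and> p = 2 \<and> i = Hold \<and> (x = Bottom \<or> \<not> c))},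
     init = 0, final = {2}\<rparr>"

definition witness_word :: "bool \<Rightarrow> nat \<Rightarrow> nat list" where
  "witness_word c n = replicate n 0 @ (if c then replicate n 1 else [])"

lemma witness_simps [simp]:
  "states (witness l c) = {0, 1, 2}" "input_alph (witness l c) = {0, 1}"
  "work_alph (witness l c) = {0, 1}" "init (witness l c) = 0" "final (witness l c) = {2}"
  by (simp_all add: witness_def)

lemma witness_delta:
  "((q, a, x), (p, i)) \<in> delta (witness l c) \<longleftrightarrow> x \<in> {Bottom, Sym 0, Sym 1} \<and>
       (q = 0 \<and> a = Some 0 \<and> p = 0 \<and> i = Push 0 \<or>
        q = 0 \<and> a = None \<and> p = 0 \<and> i = Push 1 \<and> l \<or>
        q = 0 \<and> a = None \<and> p = 1 \<and> i = Stay \<or>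
        q = 1 \<and> a = Some 1 \<and> p = 1 \<and> i = Down \<and> x = Sym 0 \<and> c \<or>
        q = 1 \<and> a = None \<and> p = 1 \<and> i = Down \<and> x = Sym 1 \<and> c \<or>
        q = 1 \<and> a = None \<and> p = 2 \<and> i = Hold \<and> (x = Bottom \<or> \<not> c))"
  by (simp add: witness_def)

lemma checking_stack_automaton_witness: "checking_stack_automaton (witness l c)"
proof -
  have "stack_automaton (witness l c)"
  proof -
    have "((q, a, x), (p, i)) \<in> (states (witness l c) \<times> insert None (Some ` input_alph (witness l c))
        \<times> stack_alph (witness l c)) \<times> (states (witness l c) \<times> instrs (witness l c))"
      if "((q, a, x), (p, i)) \<in> delta (witness l c)" for q a x p i
    proof -
      have "x \<in> stack_alph (witness l c)"
        using that unfolding witness_delta by (simp add: stack_alph_def) blast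
      moreover have "q \<in> states (witness l c)" "p \<in> states (witness l c)"
        "a \<in> insert None (Some ` input_alph (witness l c))" "i \<in> instrs (witness l c)"
        using that unfolding witness_delta by (elim conjE disjE; simp add: instrs_def)+
      ultimately show ?thesis by blast
    qed
    then have "delta (witness l c) \<subseteq> (states (witness l c) \<times> insert None (Some ` input_alph (witness l c))
        \<times> stack_alph (witness l c)) \<times> (states (witness l c) \<times> instrs (witness l c))"
      by (simp only: subset_iff split_paired_All) blast
    then show ?thesis unfolding stack_automaton_def by simp
  qed
  moreover have "non_erasing (witness l c)"
    by (auto simp: non_erasing_def witness_delta)
  moreover have "partitioned_into (witness l c) {0} {1, 2}"
    by (auto simp: partitioned_into_def witness_delta)
  moreover have "p \<notin> {0}" if "((q, a, x), (p, i)) \<in> delta (witness l c)" "q \<in> {1, 2}" for q a x p i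
    using that by (auto simp: witness_delta)
  ultimately show ?thesis
    unfolding checking_stack_automaton_def by blast
qed

section \<open>Runs, languages and space of the witnesses\<close>

text \<open>Each 0 is pushed by reading a 0. The symbol 1 is padding, pushed without input and
  available only under the flag \<open>l\<close>.\<close>

lemma witness_write:
  assumes "lpath (wstep (delta (witness l c))) (0, []) u (q, w)"
  shows "q \<in> {0, 1}" "set w \<subseteq> {0, 1}" "u = replicate (count_list w 0) 0" "\<not> l \<Longrightarrow> count_list w 0 = length w"
proof -
  have "fst d \<in> {0, 1} \<and> set (snd d) \<subseteq> {0, 1} \<and> u = replicate (count_list (snd d) 0) 0 \<and>
      (\<not> l \<longrightarrow> count_list (snd d) 0 = length (snd d))"
    if "lpath (wstep (delta (witness l c))) (0, []) u d" for u d
    using that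
  proof (induction rule: lpath_snoc_induct)
    case nil
    then show ?case by simp
  next
    case (snoc u d a d')
    from snoc.hyps(2) show ?case
    proof cases
      case (stay q w p)
      then have "a = None \<and> p = 1" by (simp add: witness_delta)
      with stay snoc.IH show ?thesis by simp
    next
      case (push q w p y)
      then have "p = 0 \<and> (a = Some 0 \<and> y = 0 \<or> a = None \<and> y = 1 \<and> l)"
        unfolding witness_delta by blast
      with push snoc.IH show ?thesis by (elim conjE disjE) (simp_all add: replicate_append_same)
    qed
  qed
  from this[OF assms] show "q \<in> {0, 1}" "set w \<subseteq> {0, 1}" "u = replicate (count_list w 0) 0"
    "\<not> l \<Longrightarrow> count_list w 0 = length w" by auto
qed

lemma tape_nth: "0 < k \<Longrightarrow> k \<le> length w \<Longrightarrow> tape w ! k = Sym (w ! (k - 1))"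
  by (cases k) (auto simp: tape_def nth_append)

lemma count_list_take:
  "0 < k \<Longrightarrow> k \<le> length w \<Longrightarrow> count_list (take k w) x = count_list (take (k - 1) w) x + (if w ! (k - 1) = x then 1 else 0)"
  by (cases k) (auto simp: take_Suc_conv_app_nth)

text \<open>Under the flag \<open>c\<close> the number of ones read plus the number of zeros in the
  cells up to the head is invariant. State 2 is entered only at the bottom, where no zeros remain.
  Without \<open>c\<close> the head does not move and nothing is read.\<close>

lemma witness_read:
  assumes "lpath (rstep (delta (witness l c)) (tape w)) (q, int (length w)) u (2, h)" "q \<in> {0, 1}"
  shows "u = (if c then replicate (count_list w 0) 1 else [])"
proof -
  let ?z = "\<lambda>k. count_list (take (nat k) w) 0"
  have "0 \<le> snd d \<and> snd d \<le> int (length w) \<and> (fst d = 0 \<longrightarrow> u = []) \<and>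
      (if c then \<exists>m. u = replicate m 1 \<and> m + ?z (snd d) = count_list w 0 \<and> (fst d = 2 \<longrightarrow> snd d = 0)
       else u = [])"
    if "lpath (rstep (delta (witness l c)) (tape w)) (q, int (length w)) u d" for u d
    using that
  proof (induction rule: lpath_snoc_induct)
    case nil
    then show ?case using assms(2) by auto
  next
    case (snoc u d a d')
    let ?k = "nat (snd d)"
    from snoc.hyps(2) obtain i where i: "((fst d, a, tape w ! ?k), (fst d', i)) \<in> delta (witness l c)"
      "(i, snd d' - snd d) \<in> moves" "0 \<le> snd d'"
      by (auto simp: rstep_def)
    from i(1,2) consider (down) "c" "fst d = 1" "fst d' = 1" "snd d' = snd d - 1"
        "a = Some 1 \<and> tape w ! ?k = Sym 0 \<or> a = None \<and> tape w ! ?k = Sym 1"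
      | (hold) "fst d = 1" "a = None" "fst d' = 2" "snd d' = snd d" "c \<longrightarrow> tape w ! ?k = Bottom"
      by (auto simp: witness_delta moves_def)
    then show ?case
    proof cases
      case down
      then obtain m where m: "u = replicate m 1" "m + ?z (snd d) = count_list w 0"
        using snoc.IH by auto
      have k: "0 < ?k" "?k \<le> length w" "nat (snd d') = ?k - 1"
        using down(4) i(3) snoc.IH by auto
      have "m + length (consumed a) + ?z (snd d') = count_list w 0"
        using m(2) count_list_take[OF k(1,2), of 0] tape_nth[OF k(1,2)] down(5) k(3) by auto
      moreover have "u @ consumed a = replicate (m + length (consumed a)) 1"
        using m(1) down(5) by (auto simp: replicate_append_same)
      ultimately show ?thesis using down snoc.IH i(3) by auto
    next
      case hold
      have "c \<Longrightarrow> snd d = 0"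
        using hold(5) nth_tape_eq_Bottom[of ?k w] snoc.IH by auto
      then show ?thesis using hold snoc.IH by auto
    qed
  qed
  from this[OF assms(1)] show ?thesis by (auto split: if_splits)
qed

text \<open>The stack word is general because it serves two purposes: words of zeros give the
  language, and words of padding give unbounded stacks on the empty input.\<close>

lemma witness_accepts:
  fixes w :: "nat list"
  assumes "set w \<subseteq> {0, 1}" "l \<or> 1 \<notin> set w"
  shows "length w \<in> sizes z (witness l c) (witness_word c (count_list w 0))"
proof -
  let ?D = "delta (witness l c)"
  have top: "top_sym w \<in> {Bottom, Sym 0, Sym 1}" if "set w \<subseteq> {0, 1}" for w :: "nat list"
    using that by (cases w rule: rev_cases) auto
  have wp0: "lpath (wstep ?D) (0, []) (replicate (count_list w 0) 0) (0, w)"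
    using assms
  proof (induction w rule: rev_induct)
    case Nil
    show ?case by (simp add: lpath.nil)
  next
    case (snoc y w)
    let ?a = "if y = 0 then Some 0 else None"
    have "y = 0 \<or> y = 1 \<and> l" "set w \<subseteq> {0, 1}" using snoc.prems by auto
    then have "((0, ?a, top_sym w), (0, Push y)) \<in> ?D"
      using top[of w] by (elim disjE) (simp_all add: witness_delta)
    then have "wstep ?D (0, w) ?a (0, w @ [y])" by (rule wstep.push)
    with snoc have "lpath (wstep ?D) (0, []) (replicate (count_list w 0) 0 @ consumed ?a) (0, w @ [y])"
      by (intro lpath_snoc[of "wstep ?D"]) auto
    moreover have "replicate (count_list w 0) 0 @ consumed ?a = replicate (count_list (w @ [y]) 0) (0 :: nat)"
      by (auto simp: replicate_append_same)
    ultimately show ?case by simp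
  qed
  have "wstep ?D (0, w) None (1, w)"
    using top[OF assms(1)] by (intro wstep.stay) (simp add: witness_delta)
  from lpath_snoc[of "wstep ?D", OF wp0 this]
  have wp: "lpath (wstep ?D) (0, []) (replicate (count_list w 0) 0) (1, w)" by simp
  have down: "lpath (rstep ?D (tape w)) (1, int k) (replicate (count_list (take k w) 0) 1) (1, 0)"
    if c "k \<le> length w" for k
    using that(2)
  proof (induction k)
    case 0
    show ?case by (simp add: lpath.nil)
  next
    case (Suc k)
    let ?a = "if w ! k = 0 then Some 1 else None"
    have "w ! k \<in> set w" using Suc.prems by simp
    with assms(1) have "w ! k \<in> {0, 1}" by blast
    then have "((1, ?a, tape w ! Suc k), (1, Down)) \<in> ?D"
      using tape_nth[of "Suc k" w] Suc.prems \<open>c\<close> by (elim insertE) (simp_all add: witness_delta)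
    then have "rstep ?D (tape w) (1, int (Suc k)) ?a (1, int k)"
      using Suc.prems unfolding rstep_def by (intro conjI exI[of _ Down]) (auto simp: moves_def nat_add_distrib)
    then have "lpath (rstep ?D (tape w)) (1, int (Suc k)) (consumed ?a @ replicate (count_list (take k w) 0) 1) (1, 0)"
      using Suc by (intro lpath.cons[of "rstep ?D (tape w)"]) auto
    moreover have "consumed ?a @ replicate (count_list (take k w) 0) 1 = replicate (count_list (take (Suc k) w) 0) (1 :: nat)"
      using Suc.prems by (auto simp: take_Suc_conv_app_nth)
    ultimately show ?case by simp
  qed
  have "\<exists>h. lpath (rstep ?D (tape w)) (1, int (length w)) (if c then replicate (count_list w 0) 1 else []) (2, h)"
  proof (cases c)
    case True
    have "((1, None, tape w ! 0), (2, Hold)) \<in> ?D"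
      by (simp add: witness_delta tape_def)
    then have "rstep ?D (tape w) (1, 0) None (2, 0)"
      unfolding rstep_def by (intro conjI exI[of _ Hold]) (auto simp: moves_def)
    from lpath_snoc[of "rstep ?D (tape w)", OF down[OF True order_refl] this] True show ?thesis
      by (intro exI[of _ 0]) simp
  next
    case False
    have "tape w ! length w = top_sym w"
      by (cases w rule: rev_cases) (auto simp: tape_def nth_append)
    then have "((1, None, tape w ! length w), (2, Hold)) \<in> ?D"
      using top[OF assms(1)] False by (simp add: witness_delta)
    then have "rstep ?D (tape w) (1, int (length w)) None (2, int (length w))"
      unfolding rstep_def by (intro conjI exI[of _ Hold]) (auto simp: moves_def)
    from lpath_single[of "rstep ?D (tape w)", OF this] False show ?thesis by auto
  qed
  then obtain h where rp: "lpath (rstep ?D (tape w)) (1, int (length w)) (if c then replicate (count_list w 0) 1 else []) (2, h)" ..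
  have ww: "witness_word c (count_list w 0) \<in> lists (input_alph (witness l c))"
    by (auto simp: witness_word_def)
  have "length w \<in> sizes Accept (witness l c) (witness_word c (count_list w 0))"
    unfolding sizes_phases[OF checking_stack_automaton_witness ww]
  \<comment> \<open>The seven witnesses stay schematic; unification with the facts shown below
    determines them.\<close>
  proof (rule exI, rule exI, rule exI, rule exI, rule exI, rule exI, rule exI, intro conjI)
    show "length w = length w" ..
    show "lpath (wstep ?D) (init (witness l c), []) (replicate (count_list w 0) 0) (1, w)"
      using wp by simp
    show "witness_word c (count_list w 0) = replicate (count_list w 0) 0 @
        (if c then replicate (count_list w 0) 1 else []) @ []"
      by (simp add: witness_word_def)
    show "Accept = Accept \<longrightarrow> [] = [] \<and> 2 \<in> final (witness l c)" by simp
  qed (rule rp)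
  then show ?thesis using sizes_Accept_subset by blast
qed

lemma count_list_replicate: "count_list (replicate n x) y = (if x = y then n else 0)"
  by (induction n) auto

lemma witness_language: "accepted_language (witness l c) = range (witness_word c)"
proof (intro equalityI subsetI)
  have ne: "non_erasing (witness l c)"
    using checking_stack_automaton_witness by (simp add: checking_stack_automaton_def)
  fix u assume "u \<in> accepted_language (witness l c)"
  then obtain n where u: "u \<in> lists (input_alph (witness l c))" "n \<in> sizes Accept (witness l c) u"
    unfolding accepted_language_eq[OF ne] by blast
  then obtain w u1 u2 q h where ph: "u = u1 @ u2"
    "lpath (wstep (delta (witness l c))) (0, []) u1 (q, w)"
    "lpath (rstep (delta (witness l c)) (tape w)) (q, int (length w)) u2 (2, h)"
    unfolding sizes_phases[OF checking_stack_automaton_witness u(1)] by auto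
  have "u = witness_word c (count_list w 0)"
    unfolding witness_word_def ph(1) witness_write(3)[OF ph(2)]
      witness_read[OF ph(3) witness_write(1)[OF ph(2)]] ..
  then show "u \<in> range (witness_word c)" by blast
next
  have ne: "non_erasing (witness l c)"
    using checking_stack_automaton_witness by (simp add: checking_stack_automaton_def)
  fix u assume "u \<in> range (witness_word c)"
  then obtain n where u: "u = witness_word c n" by blast
  then have "u \<in> lists (input_alph (witness l c))" by (auto simp: witness_word_def)
  moreover have "set (replicate n (0 :: nat)) \<subseteq> {0, 1}" "l \<or> 1 \<notin> set (replicate n (0 :: nat))" by auto
  from witness_accepts[OF this, of Accept c] have "sizes Accept (witness l c) u \<noteq> {}"
    unfolding u count_list_replicate by auto
  ultimately show "u \<in> accepted_language (witness l c)"
    unfolding accepted_language_eq[OF ne] by blast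
qed

text \<open>With \<open>c\<close>, the prefixes consisting of \<open>i\<close> and \<open>j\<close>
  zeros are separated by the continuation of \<open>i\<close> ones. Without \<open>c\<close>, the
  language consists of all words of zeros, whose only residuals are itself and the empty
  set.\<close>

lemma witness_regular_iff:
  "regular_language (input_alph (witness l c)) (accepted_language (witness l c)) \<longleftrightarrow> \<not> c"
proof (cases c)
  case True
  have mem: "replicate j 0 @ replicate i 1 \<in> range (witness_word c) \<longleftrightarrow> i = j" for i j
  proof
    assume "replicate j 0 @ replicate i 1 \<in> range (witness_word c)"
    then obtain n where "replicate j 0 @ replicate i 1 = replicate n 0 @ replicate n (1 :: nat)"
      using True by (auto simp: witness_word_def)
    then have "count_list (replicate j 0 @ replicate i 1) y = count_list (replicate n 0 @ replicate n (1 :: nat)) y" for y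
      by simp
    from this[of 0] this[of 1] show "i = j" by (simp add: count_list_replicate)
  next
    assume "i = j"
    then have "replicate j 0 @ replicate i 1 = witness_word c i" using True by (simp add: witness_word_def)
    then show "replicate j 0 @ replicate i 1 \<in> range (witness_word c)" by simp
  qed
  have "\<not> regular_language {0, 1} (range (witness_word c))"
  proof (rule not_regular_languageI)
    show "replicate i 0 \<in> lists {0, 1 :: nat}" for i by auto
    show "\<exists>v\<in>lists {0, 1}. (replicate i 0 @ v \<in> range (witness_word c)) \<noteq> (replicate j 0 @ v \<in> range (witness_word c))"
      if "i < j" for i j
      using that mem[of i i] mem[of j i] by (intro bexI[of _ "replicate i 1"]) auto
  qed
  with True show ?thesis by (simp add: witness_language)
next
  case False
  have L: "range (witness_word c) = {u. set u \<subseteq> {0}}"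
  proof (intro equalityI subsetI)
    fix u assume "u \<in> range (witness_word c)"
    then obtain n where "u = replicate n 0" using False by (auto simp: witness_word_def)
    then show "u \<in> {u. set u \<subseteq> {0}}" by auto
  next
    fix u :: "nat list" assume "u \<in> {u. set u \<subseteq> {0}}"
    then have "u = replicate (length u) 0" by (intro replicate_eqI) auto
    then have "u = witness_word c (length u)" using False by (simp add: witness_word_def)
    then show "u \<in> range (witness_word c)" by blast
  qed
  have "{v. u @ v \<in> range (witness_word c)} \<in> {{v. set v \<subseteq> {0}}, {}}" for u
    unfolding L by (cases "set u \<subseteq> {0}") auto
  then have "(\<lambda>u. {v. u @ v \<in> range (witness_word c)}) ` lists {0, 1} \<subseteq> {{v. set v \<subseteq> {0}}, {}}"
    by (rule image_subsetI)
  then have "finite ((\<lambda>u. {v. u @ v \<in> range (witness_word c)}) ` lists {0, 1})"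
    by (rule finite_subset) simp
  then have "regular_language {0, 1} (range (witness_word c))"
    by (intro regular_language_if_finite_residuals) (auto simp: L)
  with False show ?thesis by (simp add: witness_language)
qed

text \<open>On the empty input every number \<open>k\<close> of padding symbols leads to acceptance,
  so every size is attained already there.\<close>

lemma witness_unlimited: "unlimited_case z (witness True c)"
proof -
  have "k \<in> sizes z (witness True c) []" for k
  proof -
    have "set (replicate k 1) \<subseteq> {0, 1 :: nat}" by auto
    from witness_accepts[OF this, of True z c] show ?thesis
      by (cases c) (simp_all add: witness_word_def count_list_replicate)
  qed
  then have "sizes z (witness True c) [] = UNIV" by blast
  then have "infinite (sizes z (witness True c) [])" by simp
  then have "unlimited z (witness True c)"
    using limited_iff_finite_sizes[OF checking_stack_automaton_witness, of z True c] by force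
  then show ?thesis by (rule unlimited_caseI)
qed

text \<open>Without padding each pushed symbol costs a letter, so sizes are at most the input
  length; stacks of zeros make them unbounded.\<close>

lemma witness_linear: "linear_case z (witness False c)"
proof (rule linear_caseI[OF checking_stack_automaton_witness])
  have "n \<le> length u" if "u \<in> lists (input_alph (witness False c))" "n \<in> sizes z (witness False c) u" for u n
  proof -
    note u = that(1) and un = that(2)
    obtain w u1 u2 v q where n: "n = length w" and u12: "u = u1 @ u2 @ v"
      and wp: "lpath (wstep (delta (witness False c))) (0, []) u1 (q, w)"
      using un unfolding sizes_phases[OF checking_stack_automaton_witness u] witness_simps by blast
    have "u1 = replicate (length w) 0"
      using witness_write(3)[OF wp] witness_write(4)[OF wp] by simp
    with n u12 show ?thesis by simp
  qed
  then have "finite (sizes z (witness False c) u)" if "u \<in> lists (input_alph (witness False c))" for u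
    using that by (meson finite_nat_set_iff_bounded_le)
  then show "limited z (witness False c)"
    by (simp only: limited_iff_finite_sizes[OF checking_stack_automaton_witness]) blast
next
  fix B
  let ?w = "replicate (Suc B) (0 :: nat)"
  have "Suc B \<in> sizes z (witness False c) (witness_word c (count_list ?w 0))"
  proof -
    have "set ?w \<subseteq> {0, 1}" "False \<or> 1 \<notin> set ?w" by auto
    from witness_accepts[OF this, of z c] show ?thesis by simp
  qed
  moreover have "witness_word c n \<in> lists (input_alph (witness False c))" for n
    by (auto simp: witness_word_def)
  ultimately show "\<exists>u\<in>lists (input_alph (witness False c)). \<exists>n\<in>sizes z (witness False c) u. n > B"
    by (meson lessI)
qed

text \<open>The trichotomy holds for arbitrary types of states, letters and stack symbols. Case 1
  excludes the others because they contain \<open>limited\<close>; only cases 2 and 3 have to be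
  separated by growth.\<close>

theorem theorem9:
  shows "(\<forall>M :: ('q, 'a, 'g) sa. checking_stack_automaton M \<longrightarrow>
            (\<forall>z. (unlimited_case z M \<or> constant_case z M \<or> linear_case z M) \<and>
                 \<not> (unlimited_case z M \<and> constant_case z M) \<and>
                 \<not> (unlimited_case z M \<and> linear_case z M) \<and>
                 \<not> (constant_case z M \<and> linear_case z M)))
       \<and> (\<forall>z. (\<exists>M :: (nat, nat, nat) sa. checking_stack_automaton M \<and> unlimited_case z M \<and>
                   regular_language (input_alph M) (accepted_language M))
             \<and> (\<exists>M :: (nat, nat, nat) sa. checking_stack_automaton M \<and> unlimited_case z M \<and>
                   \<not> regular_language (input_alph M) (accepted_language M))
             \<and> (\<exists>M :: (nat, nat, nat) sa. checking_stack_automaton M \<and> linear_case z M \<and>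
                   regular_language (input_alph M) (accepted_language M))
             \<and> (\<exists>M :: (nat, nat, nat) sa. checking_stack_automaton M \<and> linear_case z M \<and>
                   \<not> regular_language (input_alph M) (accepted_language M)))"
proof (intro conjI allI impI)
  fix M :: "('q, 'a, 'g) sa" and z
  assume "checking_stack_automaton M"
  then show "unlimited_case z M \<or> constant_case z M \<or> linear_case z M" by (rule trichotomy)
  show "\<not> (unlimited_case z M \<and> constant_case z M)" "\<not> (unlimited_case z M \<and> linear_case z M)"
    by (auto simp: unlimited_case_def constant_case_def linear_case_def)
  show "\<not> (constant_case z M \<and> linear_case z M)" by (rule not_constant_and_linear)
next
  fix z
  note facts = checking_stack_automaton_witness witness_unlimited witness_linear witness_regular_iff
  show "\<exists>M :: (nat, nat, nat) sa. checking_stack_automaton M \<and> unlimited_case z M \<and>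
      regular_language (input_alph M) (accepted_language M)"
    using facts by (intro exI[of _ "witness True False"]) simp
  show "\<exists>M :: (nat, nat, nat) sa. checking_stack_automaton M \<and> unlimited_case z M \<and>
      \<not> regular_language (input_alph M) (accepted_language M)"
    using facts by (intro exI[of _ "witness True True"]) simp
  show "\<exists>M :: (nat, nat, nat) sa. checking_stack_automaton M \<and> linear_case z M \<and>
      regular_language (input_alph M) (accepted_language M)"
    using facts by (intro exI[of _ "witness False False"]) simp
  show "\<exists>M :: (nat, nat, nat) sa. checking_stack_automaton M \<and> linear_case z M \<and>
      \<not> regular_language (input_alph M) (accepted_language M)"
    using facts by (intro exI[of _ "witness False True"]) simp
qed

end
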